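(* Let $\mathcal{A}=\mathcal{A}_n^{\bar q,\Lambda}(\mathbb{K})$ with no $q_k$ a root of unity, and let $\varphi\in\mathrm{Aut}_{\mathbb{K}}(\mathcal{A})$. Then there exist a permutation $\sigma$ of $\{1,\dots,n\}$ and $\alpha_1,\dots,\alpha_n\in\mathbb{K}^*$ such that for each $i$, either $\varphi(x_i)=\alpha_ix_{\sigma(i)},\ \varphi(y_i)=\alpha_i^{-1}y_{\sigma(i)}$ and $q_i=q_{\sigma(i)}$, or $\varphi(x_i)=\alpha_iy_{\sigma(i)},\ \varphi(y_i)=-q_i^{-1}\alpha_i^{-1}x_{\sigma(i)}$ and $q_i=q_{\sigma(i)}^{-1}$.
   Context: Let $\mathbb{K}$ be a field, $n\ge 1$, $\bar q=(q_1,\dots,q_n)\in(\mathbb{K}^* )^n$, and $\Lambda=(\lambda_{ij})$ an $n\times n$ matrix over $\mathbb{K}^*$ with $\lambda_{ij}=\lambda_{ji}^{-1}$, $\lambda_{ii}=1$. $\mathcal{A}_n^{\bar q,\Lambda}(\mathbb{K})$ is the $\mathbb{K}$-algebra generated by $x_1,y_1,\dots,x_n,y_n$ with relations: for $1\le i<j\le n$, $x_ix_j=\lambda_{ij}x_jx_i$, $y_jy_i=\lambda_{ji}y_iy_j$, $x_iy_j=\lambda_{ji}y_jx_i$, $x_jy_i=\lambda_{ij}y_ix_j$; and $x_iy_i-q_iy_ix_i=1$ for all $i$. *)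

theory Defs
  imports Main "HOL-Combinatorics.Permutations"
begin

text \<open>Generators: (i, True) stands for x_i, (i, False) stands for y_i (0-based indices).
  The free associative K-algebra on these generators is modelled as functions from words
  (lists of generators) to K with finite support.\<close>

type_synonym gen = "nat \<times> bool"
type_synonym 'k fa = "gen list \<Rightarrow> 'k"

definition fa_add :: "'k::field fa \<Rightarrow> 'k fa \<Rightarrow> 'k fa" where
  "fa_add f g = (\<lambda>w. f w + g w)"

definition fa_sub :: "'k::field fa \<Rightarrow> 'k fa \<Rightarrow> 'k fa" where
  "fa_sub f g = (\<lambda>w. f w - g w)"

definition fa_smult :: "'k::field \<Rightarrow> 'k fa \<Rightarrow> 'k fa" where
  "fa_smult c f = (\<lambda>w. c * f w)"

definition fa_zero :: "'k::field fa" where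
  "fa_zero = (\<lambda>w. 0)"

definition fa_one :: "'k::field fa" where
  "fa_one = (\<lambda>w. if w = [] then 1 else 0)"

definition fa_mult :: "'k::field fa \<Rightarrow> 'k fa \<Rightarrow> 'k fa" where
  "fa_mult f g = (\<lambda>w. \<Sum>k\<in>{0..length w}. f (take k w) * g (drop k w))"

definition fa_gen :: "gen \<Rightarrow> 'k::field fa" where
  "fa_gen a = (\<lambda>w. if w = [a] then 1 else 0)"

definition X :: "nat \<Rightarrow> 'k::field fa" where "X i = fa_gen (i, True)"
definition Y :: "nat \<Rightarrow> 'k::field fa" where "Y i = fa_gen (i, False)"

definition FA :: "nat \<Rightarrow> 'k::field fa set" where
  "FA n = {f. finite {w. f w \<noteq> 0} \<and> (\<forall>w. f w \<noteq> 0 \<longrightarrow> (\<forall>a\<in>set w. fst a < n))}"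

definition rels :: "nat \<Rightarrow> (nat \<Rightarrow> 'k::field) \<Rightarrow> (nat \<Rightarrow> nat \<Rightarrow> 'k) \<Rightarrow> 'k fa set" where
  "rels n q \<Lambda> =
     {fa_sub (fa_mult (X i) (X j)) (fa_smult (\<Lambda> i j) (fa_mult (X j) (X i))) | i j. i < j \<and> j < n}
   \<union> {fa_sub (fa_mult (Y j) (Y i)) (fa_smult (\<Lambda> j i) (fa_mult (Y i) (Y j))) | i j. i < j \<and> j < n}
   \<union> {fa_sub (fa_mult (X i) (Y j)) (fa_smult (\<Lambda> j i) (fa_mult (Y j) (X i))) | i j. i < j \<and> j < n}
   \<union> {fa_sub (fa_mult (X j) (Y i)) (fa_smult (\<Lambda> i j) (fa_mult (Y i) (X j))) | i j. i < j \<and> j < n}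
   \<union> {fa_sub (fa_sub (fa_mult (X i) (Y i)) (fa_smult (q i) (fa_mult (Y i) (X i)))) fa_one | i. i < n}"

inductive_set rel_ideal :: "nat \<Rightarrow> (nat \<Rightarrow> 'k::field) \<Rightarrow> (nat \<Rightarrow> nat \<Rightarrow> 'k) \<Rightarrow> 'k fa set"
  for n q \<Lambda> where
  gen: "r \<in> rels n q \<Lambda> \<Longrightarrow> r \<in> rel_ideal n q \<Lambda>"
| zero: "fa_zero \<in> rel_ideal n q \<Lambda>"
| add: "a \<in> rel_ideal n q \<Lambda> \<Longrightarrow> b \<in> rel_ideal n q \<Lambda> \<Longrightarrow> fa_add a b \<in> rel_ideal n q \<Lambda>"
| mult: "a \<in> rel_ideal n q \<Lambda> \<Longrightarrow> u \<in> FA n \<Longrightarrow> v \<in> FA n \<Longrightarrow>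
           fa_mult (fa_mult u a) v \<in> rel_ideal n q \<Lambda>"

definition eqA :: "nat \<Rightarrow> (nat \<Rightarrow> 'k::field) \<Rightarrow> (nat \<Rightarrow> nat \<Rightarrow> 'k) \<Rightarrow> 'k fa \<Rightarrow> 'k fa \<Rightarrow> bool" where
  "eqA n q \<Lambda> a b \<longleftrightarrow> fa_sub a b \<in> rel_ideal n q \<Lambda>"

text \<open>A K-algebra automorphism of A, represented by a lift \<phi> : FA n \<rightarrow> FA n
  that is well defined on classes, a K-algebra homomorphism modulo the ideal, and
  bijective on classes.\<close>
definition is_autA :: "nat \<Rightarrow> (nat \<Rightarrow> 'k::field) \<Rightarrow> (nat \<Rightarrow> nat \<Rightarrow> 'k) \<Rightarrow> ('k fa \<Rightarrow> 'k fa) \<Rightarrow> bool" where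
  "is_autA n q \<Lambda> \<phi> \<longleftrightarrow>
     (\<forall>a\<in>FA n. \<phi> a \<in> FA n)
   \<and> (\<forall>a\<in>FA n. \<forall>b\<in>FA n. eqA n q \<Lambda> a b \<longrightarrow> eqA n q \<Lambda> (\<phi> a) (\<phi> b))
   \<and> (\<forall>a\<in>FA n. \<forall>b\<in>FA n. eqA n q \<Lambda> (\<phi> (fa_add a b)) (fa_add (\<phi> a) (\<phi> b)))
   \<and> (\<forall>c. \<forall>a\<in>FA n. eqA n q \<Lambda> (\<phi> (fa_smult c a)) (fa_smult c (\<phi> a)))
   \<and> (\<forall>a\<in>FA n. \<forall>b\<in>FA n. eqA n q \<Lambda> (\<phi> (fa_mult a b)) (fa_mult (\<phi> a) (\<phi> b)))
   \<and> eqA n q \<Lambda> (\<phi> fa_one) fa_one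
   \<and> (\<forall>a\<in>FA n. \<forall>b\<in>FA n. eqA n q \<Lambda> (\<phi> a) (\<phi> b) \<longrightarrow> eqA n q \<Lambda> a b)
   \<and> (\<forall>b\<in>FA n. \<exists>a\<in>FA n. eqA n q \<Lambda> (\<phi> a) b)"

end

theory Submission
  imports Defs "HOL-Library.Poly_Mapping"
begin

text \<open>
  Put \<open>z\<^sub>k = 1 + (q\<^sub>k - 1) y\<^sub>k x\<^sub>k\<close>, so that \<open>x\<^sub>k z\<^sub>k = q\<^sub>k z\<^sub>k x\<^sub>k\<close> while \<open>z\<^sub>k\<close> commutes with the other
  generators. Since \<open>y\<^sub>k = (q\<^sub>k - 1)\<^sup>-\<^sup>1 (z\<^sub>k - 1) x\<^sub>k\<^sup>-\<^sup>1\<close>, the algebra embeds into the quantum torus in the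
  \<open>x\<^sub>k\<close> and \<open>z\<^sub>k\<close>, a twisted group algebra of an ordered group, where leading and lowest exponents are
  additive. Comparing them shows that the normal elements of the algebra are the scalar multiples of
  monomials in the \<open>z\<^sub>k\<close>. An automorphism preserves normality, hence permutes the irreducible normal
  elements \<open>z\<^sub>k\<close> up to scalars. Commutation with the \<open>z\<^sub>k\<close> then forces the images of \<open>x\<^sub>i\<close> and \<open>y\<^sub>i\<close> to
  have \<open>x\<close>-degrees \<open>d\<close> and \<open>-d\<close> in the single index \<open>\<sigma>(i)\<close>. Their product is linear in \<open>z\<close>, and as the elements
  of negative degree vanish at prescribed powers of \<open>q\<close>, this leaves only \<open>d = 1\<close> or \<open>d = -1\<close> with constant
  coefficients.
\<close>

section \<open>Twisted group algebras of ordered abelian groups\<close>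

abbreviation (input) lookup :: "('a \<Rightarrow>\<^sub>0 'b::zero) \<Rightarrow> 'a \<Rightarrow> 'b" where "lookup \<equiv> Poly_Mapping.lookup"
abbreviation (input) keys :: "('a \<Rightarrow>\<^sub>0 'b::zero) \<Rightarrow> 'a set" where "keys \<equiv> Poly_Mapping.keys"
abbreviation (input) single :: "'a \<Rightarrow> 'b::zero \<Rightarrow> 'a \<Rightarrow>\<^sub>0 'b" where "single \<equiv> Poly_Mapping.single"

text \<open>A finitely supported function is a finite sum of singletons, so identities that are
  additive in each argument reduce to monomials.\<close>

lemma poly_mapping_additive_induct [case_names single add]:
  assumes "\<And>k v. P (single k v)"
    and "\<And>f g. P f \<Longrightarrow> P g \<Longrightarrow> P (f + g)"
  shows "P (f :: 'a \<Rightarrow>\<^sub>0 'b::comm_monoid_add)"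
proof -
  have "P (\<Sum>k\<in>A. single k (lookup f k))" if "finite A" for A
    using that
  proof (induction A rule: finite_induct)
    case empty
    show ?case using assms(1)[of undefined 0] by simp
  next
    case (insert x F)
    then show ?case using assms by simp
  qed
  moreover have "(\<Sum>k\<in>keys f. single k (lookup f k)) = f"
  proof (rule poly_mapping_eqI)
    fix k
    have "lookup (\<Sum>k\<in>keys f. single k (lookup f k)) k
        = (\<Sum>x\<in>keys f. if x = k then lookup f x else 0)"
      by (simp add: lookup_sum lookup_single when_def)
    also have "\<dots> = lookup f k"
      by (simp add: in_keys_iff)
    finally show "lookup (\<Sum>k\<in>keys f. single k (lookup f k)) k = lookup f k" .
  qed
  ultimately show ?thesis by (metis finite_keys)
qed

lemma keys_subset_singleton_eq_single:
  assumes "keys u \<subseteq> {g}"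
  shows "u = single g (lookup u g)"
proof (rule poly_mapping_eqI)
  fix k
  show "lookup u k = lookup (single g (lookup u g)) k"
    using assms by (cases "k = g") (auto simp: lookup_single in_keys_iff)
qed

lemma Max_eq_Min_keys_imp_single:
  fixes u :: "'a::linorder \<Rightarrow>\<^sub>0 'b::zero"
  assumes "Max (keys u) = g" "Min (keys u) = g"
  shows "u = single g (lookup u g)"
proof (rule keys_subset_singleton_eq_single)
  show "keys u \<subseteq> {g}"
    using assms Max_ge[of "keys u"] Min_le[of "keys u"] by (force intro: antisym)
qed

text \<open>Bimultiplicativity makes \<open>c\<close> a 2-cocycle, hence the twisted product
  associative; the linear order on exponents supplies leading and lowest terms.\<close>

locale bicharacter =
  fixes c :: "'g::linordered_ab_group_add \<Rightarrow> 'g \<Rightarrow> 'k::field"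
  assumes c_add_left: "c (g + g') h = c g h * c g' h"
    and c_add_right: "c g (h + h') = c g h * c g h'"
    and c_nonzero [simp]: "c g h \<noteq> 0"
begin

lemma c_zero_left [simp]: "c 0 h = 1"
  using c_add_left[of 0 0 h] by simp

lemma c_zero_right [simp]: "c g 0 = 1"
  using c_add_right[of g 0 0] by simp

definition tmult :: "('g \<Rightarrow>\<^sub>0 'k) \<Rightarrow> ('g \<Rightarrow>\<^sub>0 'k) \<Rightarrow> ('g \<Rightarrow>\<^sub>0 'k)" (infixl "\<odot>" 70) where
  "u \<odot> v = (\<Sum>g\<in>keys u. \<Sum>h\<in>keys v. single (g + h) (c g h * lookup u g * lookup v h))"

text \<open>Enlarging the ranges adds only zero terms. Two elements can then be summed over a common
  set, which gives additivity.\<close>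

lemma tmult_eq_sum:
  assumes "finite A" "keys u \<subseteq> A" "finite B" "keys v \<subseteq> B"
  shows "u \<odot> v = (\<Sum>g\<in>A. \<Sum>h\<in>B. single (g + h) (c g h * lookup u g * lookup v h))"
proof -
  have "u \<odot> v = (\<Sum>g\<in>A. \<Sum>h\<in>keys v. single (g + h) (c g h * lookup u g * lookup v h))"
    unfolding tmult_def by (rule sum.mono_neutral_left) (use assms in \<open>auto simp: in_keys_iff\<close>)
  also have "\<dots> = (\<Sum>g\<in>A. \<Sum>h\<in>B. single (g + h) (c g h * lookup u g * lookup v h))"
    by (intro sum.cong sum.mono_neutral_left) (use assms in \<open>auto simp: in_keys_iff\<close>)
  finally show ?thesis .
qed

lemma tmult_add_left: "(u + u') \<odot> v = u \<odot> v + u' \<odot> v"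
proof -
  let ?A = "keys u \<union> keys u'"
  have "keys (u + u') \<subseteq> ?A" by (rule keys_add)
  then show ?thesis
    by (simp add: tmult_eq_sum[of ?A _ "keys v"] lookup_add algebra_simps single_add sum.distrib)
qed

lemma tmult_add_right: "u \<odot> (v + v') = u \<odot> v + u \<odot> v'"
proof -
  let ?A = "keys v \<union> keys v'"
  have "keys (v + v') \<subseteq> ?A" by (rule keys_add)
  then show ?thesis
    by (simp add: tmult_eq_sum[of "keys u" _ ?A] lookup_add algebra_simps single_add sum.distrib)
qed

lemma tmult_zero_left [simp]: "0 \<odot> v = 0"
  by (simp add: tmult_def)

lemma tmult_zero_right [simp]: "v \<odot> 0 = 0"
  by (simp add: tmult_def)

lemma tmult_diff_left: "(u - u') \<odot> v = u \<odot> v - u' \<odot> v"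
  using tmult_add_left[of "u - u'" u' v] by (simp add: algebra_simps)

lemma tmult_diff_right: "u \<odot> (v - v') = u \<odot> v - u \<odot> v'"
  using tmult_add_right[of u "v - v'" v'] by (simp add: algebra_simps)

lemma tmult_sum_right: "v \<odot> (\<Sum>i\<in>I. f i) = (\<Sum>i\<in>I. v \<odot> f i)"
  by (induction I rule: infinite_finite_induct) (simp_all add: tmult_add_right)

lemma tmult_single_single [simp]:
  "single g \<kappa> \<odot> single h \<mu> = single (g + h) (c g h * \<kappa> * \<mu>)"
  by (simp add: tmult_def)

lemma tmult_assoc: "(u \<odot> v) \<odot> w = u \<odot> (v \<odot> w)"
proof (induction u rule: poly_mapping_additive_induct)
  case (single g \<kappa>)
  show ?case
  proof (induction v rule: poly_mapping_additive_induct)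
    case (single h \<mu>)
    show ?case
    proof (induction w rule: poly_mapping_additive_induct)
      case (single k \<nu>)
      show ?case by (simp add: c_add_left c_add_right algebra_simps)
    qed (simp add: tmult_add_right)
  qed (simp add: tmult_add_right tmult_add_left)
qed (simp add: tmult_add_left)

lemma lookup_tmult_single_left:
  "lookup (single g \<kappa> \<odot> v) h = c g (h - g) * \<kappa> * lookup v (h - g)"
proof (induction v rule: poly_mapping_additive_induct)
  case (single k \<nu>)
  show ?case by (auto simp: lookup_single when_def algebra_simps)
qed (simp add: tmult_add_right lookup_add algebra_simps)

lemma lookup_tmult_single_right:
  "lookup (u \<odot> single h \<kappa>) g = c (g - h) h * lookup u (g - h) * \<kappa>"
proof (induction u rule: poly_mapping_additive_induct)
  case (single k \<nu>)
  show ?case by (auto simp: lookup_single when_def algebra_simps)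
qed (simp add: tmult_add_left lookup_add algebra_simps)

abbreviation scal :: "'k \<Rightarrow> 'g \<Rightarrow>\<^sub>0 'k" where
  "scal \<kappa> \<equiv> single 0 \<kappa>"

lemma lookup_scal_tmult [simp]: "lookup (scal \<kappa> \<odot> v) g = \<kappa> * lookup v g"
  by (simp add: lookup_tmult_single_left)

lemma scal_central: "v \<odot> scal \<kappa> = scal \<kappa> \<odot> v"
  by (rule poly_mapping_eqI) (simp add: lookup_tmult_single_right)

lemma one_left [simp]: "1 \<odot> v = v"
  using lookup_scal_tmult[of 1 v] by (intro poly_mapping_eqI) simp

lemma one_right [simp]: "v \<odot> 1 = v"
  using scal_central[of v 1] by simp

lemma tmult_scal_right: "u \<odot> (scal \<kappa> \<odot> v) = scal \<kappa> \<odot> (u \<odot> v)"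
  by (metis scal_central tmult_assoc)

lemma scal_scal: "scal \<kappa> \<odot> (scal \<mu> \<odot> v) = scal (\<kappa> * \<mu>) \<odot> v"
  by (rule poly_mapping_eqI) (simp add: mult.assoc)

lemma scal_tmult_scal: "(scal \<kappa> \<odot> u) \<odot> (scal \<mu> \<odot> v) = scal (\<kappa> * \<mu>) \<odot> (u \<odot> v)"
  unfolding tmult_assoc[of "scal \<kappa>"] tmult_scal_right[of u] scal_scal ..

section \<open>Supports and extreme exponents of products\<close>

lemma keys_tmult: "keys (u \<odot> v) \<subseteq> {g + h | g h. g \<in> keys u \<and> h \<in> keys v}"
proof
  fix k assume "k \<in> keys (u \<odot> v)"
  then have "(\<Sum>g\<in>keys u. \<Sum>h\<in>keys v.
      lookup (single (g + h) (c g h * lookup u g * lookup v h)) k) \<noteq> 0"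
    by (simp add: tmult_def in_keys_iff lookup_sum)
  then obtain g h where "g \<in> keys u" "h \<in> keys v"
      "lookup (single (g + h) (c g h * lookup u g * lookup v h)) k \<noteq> 0"
    by (meson sum.neutral)
  then show "k \<in> {g + h | g h. g \<in> keys u \<and> h \<in> keys v}"
    by (auto simp: lookup_single when_def split: if_splits)
qed

text \<open>If \<open>g + h\<close> splits in only one way into exponents of \<open>u\<close> and
  \<open>v\<close>, a single term contributes. Agreement in the first summand suffices by
  cancellation.\<close>

lemma lookup_tmult_unique:
  assumes "g \<in> keys u" "h \<in> keys v"
    and uniq: "\<And>g' h'. g' \<in> keys u \<Longrightarrow> h' \<in> keys v \<Longrightarrow> g' + h' = g + h \<Longrightarrow> g' = g"
  shows "lookup (u \<odot> v) (g + h) = c g h * lookup u g * lookup v h"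
proof -
  have eq: "lookup (single (g' + h') (c g' h' * lookup u g' * lookup v h')) (g + h)
      = (if h' = h then if g' = g then c g h * lookup u g * lookup v h else 0 else 0)"
    if "g' \<in> keys u" "h' \<in> keys v" for g' h'
    using uniq[OF that] by (auto simp: lookup_single when_def)
  have "lookup (u \<odot> v) (g + h) = (\<Sum>g'\<in>keys u. \<Sum>h'\<in>keys v.
      if h' = h then if g' = g then c g h * lookup u g * lookup v h else 0 else 0)"
    unfolding tmult_def lookup_sum by (intro sum.cong refl eq)
  also have "\<dots> = (\<Sum>g'\<in>keys u. if g' = g then c g h * lookup u g * lookup v h else 0)"
    using assms(2) by (simp add: sum.delta)
  also have "\<dots> = c g h * lookup u g * lookup v h"
    using assms(1) by (simp add: sum.delta)
  finally show ?thesis .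
qed

text \<open>Addition is strictly monotone, so the sum of the maxima arises from one pair only and
  its coefficient is a product of nonzero scalars. In particular there are no zero divisors.\<close>

lemma Max_keys_tmult:
  assumes "u \<noteq> 0" "v \<noteq> 0"
  shows "Max (keys (u \<odot> v)) = Max (keys u) + Max (keys v)"
    and "Max (keys u) + Max (keys v) \<in> keys (u \<odot> v)"
proof -
  have ne: "keys u \<noteq> {}" "keys v \<noteq> {}" using assms by auto
  have "lookup (u \<odot> v) (Max (keys u) + Max (keys v))
      = c (Max (keys u)) (Max (keys v)) * lookup u (Max (keys u)) * lookup v (Max (keys v))"
  proof (rule lookup_tmult_unique)
    fix g h assume "g \<in> keys u" "h \<in> keys v" and e: "g + h = Max (keys u) + Max (keys v)"
    then have "g \<le> Max (keys u)" "h \<le> Max (keys v)" by simp_all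
    then show "g = Max (keys u)"
      using e by (metis add_mono_thms_linordered_field(3) leD order_le_less order_refl)
  qed (use ne in auto)
  also have "\<dots> \<noteq> 0" using ne Max_in[of "keys u"] Max_in[of "keys v"] by (simp add: in_keys_iff)
  finally show *: "Max (keys u) + Max (keys v) \<in> keys (u \<odot> v)" by (simp add: in_keys_iff)
  show "Max (keys (u \<odot> v)) = Max (keys u) + Max (keys v)"
  proof (rule Max_eqI)
    fix k assume "k \<in> keys (u \<odot> v)"
    then show "k \<le> Max (keys u) + Max (keys v)"
      using keys_tmult[of u v] by (auto intro!: add_mono)
  qed (use * in auto)
qed

lemma Min_keys_tmult:
  assumes "u \<noteq> 0" "v \<noteq> 0"
  shows "Min (keys (u \<odot> v)) = Min (keys u) + Min (keys v)"
proof -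
  have ne: "keys u \<noteq> {}" "keys v \<noteq> {}" using assms by auto
  have "lookup (u \<odot> v) (Min (keys u) + Min (keys v))
      = c (Min (keys u)) (Min (keys v)) * lookup u (Min (keys u)) * lookup v (Min (keys v))"
  proof (rule lookup_tmult_unique)
    fix g h assume "g \<in> keys u" "h \<in> keys v" and e: "g + h = Min (keys u) + Min (keys v)"
    then have "Min (keys u) \<le> g" "Min (keys v) \<le> h" by simp_all
    then show "g = Min (keys u)"
      using e by (metis add_mono_thms_linordered_field(3) leD order_le_less order_refl)
  qed (use ne in auto)
  also have "\<dots> \<noteq> 0" using ne Min_in[of "keys u"] Min_in[of "keys v"] by (simp add: in_keys_iff)
  finally have *: "Min (keys u) + Min (keys v) \<in> keys (u \<odot> v)" by (simp add: in_keys_iff)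
  show ?thesis
  proof (rule Min_eqI)
    fix k assume "k \<in> keys (u \<odot> v)"
    then show "Min (keys u) + Min (keys v) \<le> k"
      using keys_tmult[of u v] by (auto intro!: add_mono)
  qed (use * in auto)
qed

lemma tmult_eq_zero_iff [simp]: "u \<odot> v = 0 \<longleftrightarrow> u = 0 \<or> v = 0"
  using Max_keys_tmult(2)[of u v] by (metis keys_zero empty_iff tmult_zero_left tmult_zero_right)

section \<open>The action on functions of the exponents\<close>

definition tact :: "('g \<Rightarrow>\<^sub>0 'k) \<Rightarrow> ('g \<Rightarrow> 'k) \<Rightarrow> 'g \<Rightarrow> 'k" where
  "tact w F j = (\<Sum>g\<in>keys w. lookup w g * c j g * F (j + g))"

lemma tact_single [simp]: "tact (single g \<kappa>) F j = \<kappa> * c j g * F (j + g)"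
  by (simp add: tact_def)

lemma tact_add: "tact (u + v) F j = tact u F j + tact v F j"
proof -
  have *: "tact w F j = (\<Sum>g\<in>keys u \<union> keys v. lookup w g * c j g * F (j + g))"
    if "keys w \<subseteq> keys u \<union> keys v" for w
    unfolding tact_def by (rule sum.mono_neutral_left) (use that in \<open>auto simp: in_keys_iff\<close>)
  show ?thesis
    by (simp add: *[OF keys_add] *[of u] *[of v] lookup_add algebra_simps sum.distrib)
qed

lemma tact_diff: "tact (u - v) F j = tact u F j - tact v F j"
  using tact_add[of "u - v" v F j] by simp

lemma tact_cong:
  assumes "\<And>g. g \<in> keys w \<Longrightarrow> F (j + g) = G (j + g)"
  shows "tact w F j = tact w G j"
  using assms by (simp add: tact_def)

text \<open>With \<open>F\<close> extended linearly, \<open>tact w F j\<close> is the value of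
  \<open>F\<close> on the monomial of exponent \<open>j\<close> times \<open>w\<close>;
  associativity of the product makes this a left action.\<close>

lemma tact_tmult: "tact (u \<odot> v) F j = tact u (tact v F) j"
proof (induction u rule: poly_mapping_additive_induct)
  case (single g \<kappa>)
  show ?case
  proof (induction v rule: poly_mapping_additive_induct)
    case (single h \<mu>)
    show ?case by (simp add: c_add_left c_add_right algebra_simps)
  qed (simp add: tmult_add_right tact_add distrib_left)
qed (simp add: tmult_add_left tact_add)

end

section \<open>The ambient quantum torus\<close>

text \<open>Exponents of the x_k and the z_k are interleaved in one group, because the order on
  \<open>nat \<Rightarrow>\<^sub>0 int\<close> is linear and compatible with addition.\<close>

definition ex :: "nat \<Rightarrow> nat \<Rightarrow>\<^sub>0 int" where "ex k = single (2 * k) 1"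
definition ez :: "nat \<Rightarrow> nat \<Rightarrow>\<^sub>0 int" where "ez k = single (Suc (2 * k)) 1"

lemma lookup_ex: "lookup (ex k) r = (if r = 2 * k then 1 else 0)"
  and lookup_ez: "lookup (ez k) r = (if r = Suc (2 * k) then 1 else 0)"
  by (auto simp: ex_def ez_def lookup_single when_def)

lemma two_times_neq_Suc: "2 * a \<noteq> Suc (2 * b)" "Suc (2 * b) \<noteq> 2 * a"
  by presburger+

lemmas lookup_exp = lookup_ex lookup_ez lookup_add lookup_minus two_times_neq_Suc

lemma ez_eq_iff [simp]: "ez i = ez j \<longleftrightarrow> i = j"
  by (auto simp: poly_mapping_eq_iff fun_eq_iff lookup_exp)

text \<open>The order is lexicographic and the first nonzero entry of \<open>ez k\<close> is
  positive. This identifies 0 and \<open>ez s\<close> as the lowest and leading exponents of z_s -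
  1.\<close>

lemma ez_pos: "0 < ez k"
proof -
  have "less_fun (lookup 0) (lookup (ez k))"
    unfolding less_fun_def by (rule exI[of _ "Suc (2 * k)"]) (simp add: lookup_exp)
  then show ?thesis by (simp only: less_poly_mapping.rep_eq)
qed

lemma mult_inverse_cancel: "a \<noteq> 0 \<Longrightarrow> a * (inverse a * b) = (b :: 'a::field)"
  by (simp flip: mult.assoc)

locale qweyl =
  fixes n :: nat and q :: "nat \<Rightarrow> 'k::field" and \<Lambda> :: "nat \<Rightarrow> nat \<Rightarrow> 'k"
  assumes q_nz: "i < n \<Longrightarrow> q i \<noteq> 0"
    and q_nroot: "i < n \<Longrightarrow> m > 0 \<Longrightarrow> q i ^ m \<noteq> 1"
    and L_nz: "i < n \<Longrightarrow> j < n \<Longrightarrow> \<Lambda> i j \<noteq> 0"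
    and L_inv: "i < n \<Longrightarrow> j < n \<Longrightarrow> \<Lambda> i j = inverse (\<Lambda> j i)"
begin

lemma q_neq_1: "i < n \<Longrightarrow> q i \<noteq> 1"
  using q_nroot[of i 1] by simp

lemma q_powi_eq_1_iff:
  assumes "i < n"
  shows "q i powi a = 1 \<longleftrightarrow> a = 0"
proof
  assume *: "q i powi a = 1"
  show "a = 0"
  proof (rule ccontr)
    assume "a \<noteq> 0"
    have "q i ^ nat \<bar>a\<bar> = 1"
    proof (cases "a \<ge> 0")
      case True
      then show ?thesis using * by (simp add: power_int_def)
    next
      case False
      then show ?thesis using * by (simp add: power_int_def power_inverse)
    qed
    then show False using q_nroot[OF assms, of "nat \<bar>a\<bar>"] \<open>a \<noteq> 0\<close> by simp
  qed
qed simp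

lemma q_powi_inject:
  assumes "i < n" "q i powi a = q i powi b"
  shows "a = b"
proof -
  have "q i powi (a - b) = 1" using assms q_nz by (simp add: power_int_diff)
  then show ?thesis using q_powi_eq_1_iff[OF assms(1)] by simp
qed

text \<open>Each \<lambda>_ij enters on one side of the diagonal only, so that
  \<open>c (ex i) (ex j)\<close> and \<open>c (ex j) (ex i)\<close> differ by the factor
  \<lambda>_ij for i < j.\<close>

definition M :: "nat \<Rightarrow> nat \<Rightarrow> 'k" where "M i j = (if i < j then \<Lambda> i j else 1)"

lemma M_nz: "i < n \<Longrightarrow> j < n \<Longrightarrow> M i j \<noteq> 0"
  by (simp add: M_def L_nz)

text \<open>The exponent vector \<open>g\<close> stands for \<open>z\<^sup>b x\<^sup>a\<close> with \<open>a\<^sub>k\<close> at the even place \<open>2k\<close> and \<open>b\<^sub>k\<close> at the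
  odd place \<open>2k + 1\<close>; the factor \<open>c g h\<close> comes from \<open>x\<^sub>k z\<^sub>k = q\<^sub>k z\<^sub>k x\<^sub>k\<close> and \<open>x\<^sub>i x\<^sub>j = \<lambda>\<^sub>i\<^sub>j x\<^sub>j x\<^sub>i\<close>.\<close>

definition c :: "(nat \<Rightarrow>\<^sub>0 int) \<Rightarrow> (nat \<Rightarrow>\<^sub>0 int) \<Rightarrow> 'k" where
  "c g h = (\<Prod>i<n. (\<Prod>j<n. M i j powi (lookup g (2 * i) * lookup h (2 * j)))
                     * q i powi (lookup g (2 * i) * lookup h (Suc (2 * i))))"

sublocale bicharacter c
proof
  fix g g' h h'
  show "c (g + g') h = c g h * c g' h"
    unfolding c_def prod.distrib[symmetric]
    by (rule prod.cong)
       (simp_all add: lookup_add distrib_right power_int_add q_nz M_nz prod.distrib algebra_simps)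
  show "c g (h + h') = c g h * c g h'"
    unfolding c_def prod.distrib[symmetric]
    by (rule prod.cong)
       (simp_all add: lookup_add distrib_left power_int_add q_nz M_nz prod.distrib algebra_simps)
  show "c g h \<noteq> 0"
    by (simp add: c_def q_nz M_nz)
qed

notation tmult (infixl "\<odot>" 70)

lemma c_minus_left [simp]: "c (- g) h = inverse (c g h)"
  using c_add_left[of g "- g" h] by (simp add: inverse_unique)

lemma c_minus_right [simp]: "c g (- h) = inverse (c g h)"
  using c_add_right[of g h "- h"] by (simp add: inverse_unique)

lemma c_diff_left: "c (g - g') h = c g h / c g' h"
  using c_add_left[of g "- g'" h] by (simp add: field_simps)

lemma c_diff_right: "c h (g - g') = c h g / c h g'"
  using c_add_right[of h g "- g'"] by (simp add: field_simps)

lemma c_cong_left: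
  assumes "\<And>k. k < n \<Longrightarrow> lookup g (2 * k) = lookup g' (2 * k)"
  shows "c g h = c g' h"
  using assms by (simp add: c_def)

lemma c_ez_left [simp]: "c (ez k) h = 1"
  using c_cong_left[of "ez k" 0 h] by (simp add: lookup_exp)

lemma c_ez_right [simp]:
  assumes "k < n"
  shows "c g (ez k) = q k powi lookup g (2 * k)"
proof -
  have "c g (ez k) = (\<Prod>i<n. if i = k then q k powi lookup g (2 * k) else 1)"
    unfolding c_def by (rule prod.cong) (auto simp: lookup_exp)
  then show ?thesis using assms by (simp add: prod.delta)
qed

lemma c_ex_ex [simp]:
  assumes "i < n" "j < n"
  shows "c (ex i) (ex j) = M i j"
proof -
  have *: "(\<Prod>j'<n. M i j' powi (if j' = j then 1 else 0)) = M i j"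
  proof -
    have "(\<Prod>j'<n. M i j' powi (if j' = j then 1 else 0)) = (\<Prod>j'<n. if j' = j then M i j else 1)"
      by (rule prod.cong) auto
    then show ?thesis using assms by (simp add: prod.delta)
  qed
  have "c (ex i) (ex j) = (\<Prod>i'<n. if i' = i then M i j else 1)"
    unfolding c_def by (rule prod.cong) (auto simp: lookup_exp *)
  then show ?thesis using assms by (simp add: prod.delta)
qed

section \<open>The elements x_k, z_k, y_k of the torus and their relations\<close>

definition tx :: "nat \<Rightarrow> (nat \<Rightarrow>\<^sub>0 int) \<Rightarrow>\<^sub>0 'k" where "tx k = single (ex k) 1"
definition tz :: "nat \<Rightarrow> (nat \<Rightarrow>\<^sub>0 int) \<Rightarrow>\<^sub>0 'k" where "tz k = single (ez k) 1"
text \<open>This is (q_k - 1)^(-1) (z_k - 1) x_k^(-1) expanded into monomials; no twist appears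
  because \<open>c (ez k)\<close> is constantly 1.\<close>

definition ty :: "nat \<Rightarrow> (nat \<Rightarrow>\<^sub>0 int) \<Rightarrow>\<^sub>0 'k" where
  "ty k = single (ez k - ex k) (inverse (q k - 1)) - single (- ex k) (inverse (q k - 1))"

lemma M_diag [simp]: "M i i = 1"
  by (simp add: M_def)

lemma ty_tx: "k < n \<Longrightarrow> ty k \<odot> tx k = scal (inverse (q k - 1)) \<odot> (tz k - 1)"
  using q_nz[of k] q_neq_1[of k]
  by (simp add: ty_def tx_def tz_def tmult_diff_left tmult_diff_right c_diff_left lookup_exp)

lemma tx_ty: "k < n \<Longrightarrow> tx k \<odot> ty k = scal (inverse (q k - 1)) \<odot> (scal (q k) \<odot> tz k - 1)"
  using q_nz[of k] q_neq_1[of k]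
  by (simp add: ty_def tx_def tz_def tmult_diff_left tmult_diff_right c_diff_right lookup_exp mult.commute)

lemma weyl_rel:
  assumes "k < n"
  shows "tx k \<odot> ty k - scal (q k) \<odot> (ty k \<odot> tx k) = 1"
proof -
  have inv: "inverse (q k - 1) * (q k - 1) = 1"
    using q_neq_1[OF assms] by simp
  have "r * (q' * z - t) - q' * (r * (z - t)) = t" if "r * (q' - 1) = 1" for r q' z t :: 'k
    using that by algebra
  from this[OF inv] show ?thesis
    using assms by (intro poly_mapping_eqI) (simp add: tx_ty ty_tx lookup_minus)
qed

lemma tx_tz: "k < n \<Longrightarrow> l < n \<Longrightarrow> tx k \<odot> tz l = scal (if k = l then q k else 1) \<odot> (tz l \<odot> tx k)"
  by (simp add: tx_def tz_def lookup_exp add.commute)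

lemma ty_tz: "k < n \<Longrightarrow> l < n \<Longrightarrow> ty k \<odot> tz l = scal (if k = l then inverse (q k) else 1) \<odot> (tz l \<odot> ty k)"
  by (simp add: ty_def tz_def tmult_diff_left tmult_diff_right lookup_exp algebra_simps)

lemma tx_tx: "i < j \<Longrightarrow> j < n \<Longrightarrow> tx i \<odot> tx j = scal (\<Lambda> i j) \<odot> (tx j \<odot> tx i)"
  by (simp add: tx_def M_def add.commute)

lemma ty_ty: "i < j \<Longrightarrow> j < n \<Longrightarrow> ty j \<odot> ty i = scal (\<Lambda> j i) \<odot> (ty i \<odot> ty j)"
  using L_nz[of i j] L_nz[of j i] L_inv[of i j]
  by (simp add: ty_def tmult_diff_left tmult_diff_right tmult_add_right lookup_exp c_diff_left c_diff_right M_def divide_inverse mult_inverse_cancel algebra_simps)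

lemma tx_ty_less: "i < j \<Longrightarrow> j < n \<Longrightarrow> tx i \<odot> ty j = scal (\<Lambda> j i) \<odot> (ty j \<odot> tx i)"
  using L_nz[of i j] L_nz[of j i] L_inv[of i j]
  by (simp add: tx_def ty_def tmult_diff_left tmult_diff_right tmult_add_right lookup_exp c_diff_left c_diff_right M_def divide_inverse mult_inverse_cancel algebra_simps)

lemma tx_ty_greater: "i < j \<Longrightarrow> j < n \<Longrightarrow> tx j \<odot> ty i = scal (\<Lambda> i j) \<odot> (ty i \<odot> tx j)"
  using L_nz[of i j] L_nz[of j i] L_inv[of i j]
  by (simp add: tx_def ty_def tmult_diff_left tmult_diff_right tmult_add_right lookup_exp c_diff_left c_diff_right M_def divide_inverse mult_inverse_cancel algebra_simps)

section \<open>The subalgebra of the torus generated by the x_k and y_k\<close>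

inductive_set weyl :: "((nat \<Rightarrow>\<^sub>0 int) \<Rightarrow>\<^sub>0 'k) set" where
  tx: "k < n \<Longrightarrow> tx k \<in> weyl"
| ty: "k < n \<Longrightarrow> ty k \<in> weyl"
| scal: "scal \<kappa> \<in> weyl"
| add: "u \<in> weyl \<Longrightarrow> v \<in> weyl \<Longrightarrow> u + v \<in> weyl"
| tmult: "u \<in> weyl \<Longrightarrow> v \<in> weyl \<Longrightarrow> u \<odot> v \<in> weyl"

lemma weyl_one: "1 \<in> weyl"
  using weyl.scal[of 1] by simp

lemma weyl_diff: "u \<in> weyl \<Longrightarrow> v \<in> weyl \<Longrightarrow> u - v \<in> weyl"
proof -
  assume "u \<in> weyl" "v \<in> weyl"
  then have "u + scal (-1) \<odot> v \<in> weyl" by (intro weyl.intros)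
  moreover have "u + scal (-1) \<odot> v = u - v"
    by (rule poly_mapping_eqI) (simp add: lookup_add lookup_minus)
  ultimately show ?thesis by simp
qed

lemma tz_eq: "k < n \<Longrightarrow> tz k = 1 + scal (q k - 1) \<odot> (ty k \<odot> tx k)"
  using q_neq_1[of k]
  by (simp add: ty_tx tmult_assoc[symmetric])

lemma tz_weyl: "k < n \<Longrightarrow> tz k \<in> weyl"
  by (subst tz_eq) (auto intro!: weyl.intros weyl_one)

text \<open>The generators have z-exponents 0 or 1, and exponents add under products. Negative
  powers of x_k do occur; the restriction on them is captured by the test functions below.\<close>

lemma weyl_keys:
  assumes "u \<in> weyl" "g \<in> keys u"
  shows "r \<ge> 2 * n \<Longrightarrow> lookup g r = 0" "lookup g (Suc (2 * k)) \<ge> 0"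
proof -
  have "(\<forall>r\<ge>2 * n. lookup g r = 0) \<and> (\<forall>k. lookup g (Suc (2 * k)) \<ge> 0)"
    using assms
  proof (induction u arbitrary: g rule: weyl.induct)
    case (tx k)
    then show ?case by (auto simp: tx_def lookup_exp)
  next
    case (ty k)
    then have "g = ez k - ex k \<or> g = - ex k"
      using keys_diff[of "single (ez k - ex k) (inverse (q k - 1))" "single (- ex k) (inverse (q k - 1))"]
      by (auto simp: ty_def split: if_splits)
    then show ?case using ty by (auto simp: lookup_exp)
  next
    case (scal \<kappa>)
    then show ?case by (auto split: if_splits)
  next
    case (add u v)
    then show ?case using keys_add[of u v] by auto
  next
    case (tmult u v)
    then obtain g1 g2 where "g = g1 + g2" "g1 \<in> keys u" "g2 \<in> keys v"
      using keys_tmult[of u v] by auto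
    then show ?case using tmult.IH(1)[of g1] tmult.IH(2)[of g2] by (auto simp: lookup_add)
  qed
  then show "r \<ge> 2 * n \<Longrightarrow> lookup g r = 0" "lookup g (Suc (2 * k)) \<ge> 0" by auto
qed

lemma exp_eqI:
  assumes "\<And>r. r \<ge> 2 * n \<Longrightarrow> lookup g r = lookup h r"
    and "\<And>k. k < n \<Longrightarrow> lookup g (2 * k) = lookup h (2 * k)"
    and "\<And>k. k < n \<Longrightarrow> lookup g (Suc (2 * k)) = lookup h (Suc (2 * k))"
  shows "g = h"
proof (rule poly_mapping_eqI)
  fix r
  show "lookup g r = lookup h r"
    using assms(1)[of r] assms(2,3)[of "r div 2"]
    by (cases "r \<ge> 2 * n"; cases "even r") (auto elim!: evenE oddE)
qed

section \<open>Functions of the x-exponents that vanish on the nonnegative orthant\<close>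

definition xdep :: "((nat \<Rightarrow>\<^sub>0 int) \<Rightarrow> 'k) \<Rightarrow> bool" where
  "xdep F \<longleftrightarrow> (\<forall>j j'. (\<forall>k<n. lookup j (2 * k) = lookup j' (2 * k)) \<longrightarrow> F j = F j')"

definition xneg :: "((nat \<Rightarrow>\<^sub>0 int) \<Rightarrow> 'k) \<Rightarrow> bool" where
  "xneg F \<longleftrightarrow> xdep F \<and> (\<forall>j. (\<forall>k<n. lookup j (2 * k) \<ge> 0) \<longrightarrow> F j = 0)"

lemma xdep_tact:
  assumes "xdep F"
  shows "xdep (tact w F)"
  unfolding xdep_def
proof (intro allI impI)
  fix j j' :: "nat \<Rightarrow>\<^sub>0 int"
  assume j: "\<forall>k<n. lookup j (2 * k) = lookup j' (2 * k)"
  then have "c j g = c j' g" "F (j + g) = F (j' + g)" for g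
    using assms by (auto intro!: c_cong_left simp: xdep_def lookup_add)
  then show "tact w F j = tact w F j'" by (simp add: tact_def)
qed

lemma xneg_tactI:
  assumes "xneg F" "\<And>j. (\<And>k. k < n \<Longrightarrow> lookup j (2 * k) \<ge> 0) \<Longrightarrow> tact w F j = 0"
  shows "xneg (tact w F)"
  using assms xdep_tact by (simp add: xneg_def)

lemma xneg_eq_0: "xneg F \<Longrightarrow> (\<And>k. k < n \<Longrightarrow> lookup j (2 * k) \<ge> 0) \<Longrightarrow> F j = 0"
  by (simp add: xneg_def)

text \<open>The functions supported on \<open>{a. \<exists>k. a\<^sub>k < 0}\<close> form a submodule for the Weyl algebra, although not
  for the torus: \<open>y\<^sub>k\<close> carries the factor \<open>q\<^sub>k\<^sup>a - 1\<close>, which vanishes at the boundary \<open>a = 0\<close>.\<close>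

lemma xneg_tact:
  assumes "w \<in> weyl" "xneg F"
  shows "xneg (tact w F)"
  using assms
proof (induction w arbitrary: F rule: weyl.induct)
  case (tx k)
  show ?case
    by (rule xneg_tactI) (use tx in \<open>auto simp: tx_def lookup_exp intro!: xneg_eq_0\<close>)
next
  case (ty k)
  show ?case
  proof (rule xneg_tactI)
    fix j :: "nat \<Rightarrow>\<^sub>0 int" assume j: "\<And>k. k < n \<Longrightarrow> lookup j (2 * k) \<ge> 0"
    \<comment> \<open>\<open>F\<close> ignores z-exponents, so both monomials of \<open>ty k\<close>
      read the same value; the z_k in the first contributes only the scalar q_k^a, with a the
      x_k-exponent of \<open>j\<close>.\<close>
    have "F (j + (ez k - ex k)) = F (j - ex k)"
      using ty unfolding xneg_def xdep_def by (auto simp: lookup_exp)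
    then have eq: "tact (ty k) F j
        = inverse (q k - 1) * c j (- ex k) * F (j - ex k) * (q k powi (lookup j (2 * k)) - 1)"
      using ty by (simp add: ty_def tact_diff c_diff_right divide_inverse algebra_simps)
    show "tact (ty k) F j = 0"
    proof (cases "lookup j (2 * k) = 0")
      case True
      then show ?thesis by (simp add: eq)
    next
      case False
      then have "lookup j (2 * k) \<ge> 1" using j[of k] ty by simp
      then have "F (j - ex k) = 0"
        using ty j by (intro xneg_eq_0) (auto simp: lookup_exp)
      then show ?thesis by (simp add: eq)
    qed
  qed (use ty in simp)
next
  case (scal \<kappa>)
  show ?case by (rule xneg_tactI) (use scal in \<open>auto intro!: xneg_eq_0\<close>)
next
  case (add u v)
  show ?case
    by (rule xneg_tactI) (use add in \<open>auto simp: tact_add xneg_eq_0\<close>)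
next
  case (tmult u v)
  then have "xneg (tact u (tact v F))" by blast
  then show ?case by (simp add: tact_tmult xneg_def xdep_def)
qed

end

section \<open>Normal elements\<close>

context qweyl
begin

section \<open>Monomials in the z_k and normality\<close>

definition zexp :: "(nat \<Rightarrow>\<^sub>0 int) \<Rightarrow> bool" where
  "zexp g \<longleftrightarrow> (\<forall>r. lookup g r \<ge> 0) \<and> (\<forall>k. lookup g (2 * k) = 0) \<and> (\<forall>r\<ge>2 * n. lookup g r = 0)"

lemma zexpI:
  assumes "\<And>k. k < n \<Longrightarrow> lookup g (2 * k) = 0" "\<And>k. lookup g (Suc (2 * k)) \<ge> 0"
    "\<And>r. r \<ge> 2 * n \<Longrightarrow> lookup g r = 0"
  shows "zexp g"
proof -
  have even: "lookup g (2 * k) = 0" for k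
    using assms(1)[of k] assms(3)[of "2 * k"] by (cases "k < n") auto
  moreover have "lookup g r \<ge> 0" for r
    using assms(2)[of "r div 2"] even[of "r div 2"] by (cases "even r") auto
  ultimately show ?thesis using assms(3) by (simp add: zexp_def)
qed

lemma zexp_nonzeroE:
  assumes "zexp g" "g \<noteq> 0"
  obtains s where "s < n" "lookup g (Suc (2 * s)) > 0"
proof -
  obtain r where r: "lookup g r \<noteq> 0"
    using \<open>g \<noteq> 0\<close> by (auto simp: poly_mapping_eq_iff fun_eq_iff)
  then have "odd r" "r < 2 * n"
    using assms(1) by (auto simp: zexp_def elim!: evenE intro: leI)
  then obtain s where "r = Suc (2 * s)" by (auto elim!: oddE)
  moreover have "lookup g r > 0" using r assms(1) unfolding zexp_def by (metis order_le_less)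
  ultimately show thesis using that[of s] \<open>r < 2 * n\<close> by auto
qed

text \<open>A unit vector has no proper splitting into nonnegative integer vectors: z_k is
  irreducible among the monomials in the z_k.\<close>

lemma zexp_add_eq_ez:
  assumes "zexp g" "zexp h" "g + h = ez k"
  shows "g = 0 \<or> h = 0"
proof -
  have sum: "lookup g r + lookup h r = (if r = Suc (2 * k) then 1 else 0)" for r
    using arg_cong[OF assms(3), of "\<lambda>f. lookup f r"] by (simp add: lookup_exp)
  have nn: "lookup g r \<ge> 0" "lookup h r \<ge> 0" for r
    using assms by (auto simp: zexp_def)
  have other: "lookup g r = 0 \<and> lookup h r = 0" if "r \<noteq> Suc (2 * k)" for r
    using sum[of r] nn[of r] that by simp
  have "lookup g (Suc (2 * k)) = 0 \<or> lookup h (Suc (2 * k)) = 0"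
    using sum[of "Suc (2 * k)"] nn[of "Suc (2 * k)"] by auto
  then show ?thesis
    using other by (metis poly_mapping_eqI lookup_zero)
qed

text \<open>With A the subalgebra, the condition is A u \<subseteq> u A, for nonzero u in A.\<close>

definition normal_elem :: "((nat \<Rightarrow>\<^sub>0 int) \<Rightarrow>\<^sub>0 'k) \<Rightarrow> bool" where
  "normal_elem u \<longleftrightarrow> u \<in> weyl \<and> u \<noteq> 0 \<and> (\<forall>b\<in>weyl. \<exists>b'\<in>weyl. b \<odot> u = u \<odot> b')"

lemma normal_elemE:
  assumes "normal_elem u" "b \<in> weyl"
  obtains b' where "b' \<in> weyl" "b \<odot> u = u \<odot> b'"
  using assms by (auto simp: normal_elem_def)

text \<open>Leading and lowest exponents are additive, so those of \<open>u\<close> cancel and both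
  extremes of \<open>w\<close> equal \<open>g\<close>.\<close>

lemma single_tmult_eq_tmult_imp_single:
  assumes "single g \<kappa> \<odot> u = u \<odot> w" "u \<noteq> 0" "\<kappa> \<noteq> 0"
  shows "w = single g (lookup w g)"
proof (rule Max_eq_Min_keys_imp_single)
  have g: "single g \<kappa> \<noteq> 0" using assms(3) by (metis lookup_single_eq lookup_zero)
  then have w: "w \<noteq> 0" using assms by (metis tmult_eq_zero_iff)
  show "Max (keys w) = g"
    using Max_keys_tmult(1)[OF g assms(2)] Max_keys_tmult(1)[OF assms(2) w] assms(1,3) by simp
  show "Min (keys w) = g"
    using Min_keys_tmult[OF g assms(2)] Min_keys_tmult[OF assms(2) w] assms(1,3) by simp
qed

lemma single_tmult_commute_keys:
  assumes "single g \<kappa> \<odot> u = u \<odot> single g \<mu>" "h \<in> keys u"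
  shows "c g h * \<kappa> = c h g * \<mu>"
proof -
  have "c g h * \<kappa> * lookup u h = c h g * \<mu> * lookup u h"
    using arg_cong[OF assms(1), of "\<lambda>f. lookup f (g + h)"]
    by (simp add: lookup_tmult_single_left lookup_tmult_single_right mult_ac)
  then show ?thesis using assms(2) by (simp add: in_keys_iff)
qed

lemma c_ex_left:
  assumes "k < n" "\<And>i. i < n \<Longrightarrow> lookup h (2 * i) = 0"
  shows "c (ex k) h = q k powi lookup h (Suc (2 * k))"
proof -
  have "c (ex k) h = (\<Prod>i<n. if i = k then q k powi lookup h (Suc (2 * k)) else 1)"
    unfolding c_def by (rule prod.cong) (use assms(2) in \<open>auto simp: lookup_exp\<close>)
  then show ?thesis using assms(1) by (simp add: prod.delta)
qed

text \<open>Supplies test functions concentrated in one x-degree with a negative entry. Acting on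
  them and evaluating in the nonnegative orthant detects elements outside the subalgebra.\<close>

lemma xneg_indicator:
  assumes "s < n" "lookup g (2 * s) < 0" "xdep F"
  shows "xneg (\<lambda>j. if \<forall>i<n. lookup j (2 * i) = lookup g (2 * i) then F j else 0)"
  using assms by (auto simp: xneg_def xdep_def)

lemma xdep_const: "xdep (\<lambda>_. \<kappa>)"
  by (simp add: xdep_def)

text \<open>The monomials \<open>z\<^sub>k\<close> and \<open>x\<^sub>k\<close> of the torus are carried past a normal element \<open>u\<close> to multiples of
  themselves, so all exponents of \<open>u\<close> agree; what happens to \<open>y\<^sub>k\<close> excludes a power of \<open>x\<^sub>k\<close>.\<close>

lemma normal_elem_imp_single:
  assumes "normal_elem u"
  obtains g \<kappa> where "u = single g \<kappa>" "\<kappa> \<noteq> 0" "zexp g"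
proof -
  have u: "u \<in> weyl" "u \<noteq> 0" using assms by (auto simp: normal_elem_def)
  have even: "lookup h (2 * k) = lookup h' (2 * k)" if "h \<in> keys u" "h' \<in> keys u" "k < n" for h h' k
  proof -
    obtain w where "tz k \<odot> u = u \<odot> w"
      using normal_elemE[OF assms tz_weyl[OF \<open>k < n\<close>]] by blast
    then obtain \<mu> where "single (ez k) 1 \<odot> u = u \<odot> single (ez k) \<mu>"
      using single_tmult_eq_tmult_imp_single[of "ez k" 1 u w] u by (metis tz_def zero_neq_one)
    from single_tmult_commute_keys[OF this that(1)] single_tmult_commute_keys[OF this that(2)]
    have 1: "1 = q k powi lookup h (2 * k) * \<mu>" "1 = q k powi lookup h' (2 * k) * \<mu>"
      using that(3) by simp_all
    then have "\<mu> \<noteq> 0" by auto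
    with 1 have "q k powi lookup h (2 * k) = q k powi lookup h' (2 * k)" by (metis mult_right_cancel)
    then show ?thesis using q_powi_inject that(3) by blast
  qed
  have odd: "lookup h (Suc (2 * k)) = lookup h' (Suc (2 * k))"
    if "h \<in> keys u" "h' \<in> keys u" "k < n" for h h' k
  proof -
    obtain w where "tx k \<odot> u = u \<odot> w"
      using normal_elemE[OF assms weyl.tx[OF \<open>k < n\<close>]] by blast
    then obtain \<mu> where "single (ex k) 1 \<odot> u = u \<odot> single (ex k) \<mu>"
      using single_tmult_eq_tmult_imp_single[of "ex k" 1 u w] u by (metis tx_def zero_neq_one)
    from single_tmult_commute_keys[OF this that(1)] single_tmult_commute_keys[OF this that(2)]
    have "c (ex k) h = c (ex k) h'"
      using c_cong_left[of h h' "ex k"] even[OF that(1,2)] by simp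
    \<comment> \<open>The x-parts of \<open>h\<close> and \<open>h'\<close> already agree, so
      \<open>h - h'\<close> has only z-exponents and the quotient of the twists is a pure power of
      q_k.\<close>
    then have "c (ex k) (h - h') = 1" by (simp add: c_diff_right)
    moreover have "c (ex k) (h - h') = q k powi lookup (h - h') (Suc (2 * k))"
      using that even[OF that(1,2)] by (intro c_ex_left) (auto simp: lookup_minus)
    ultimately show ?thesis using q_powi_eq_1_iff[OF that(3)] by (simp add: lookup_minus)
  qed
  have "h = h'" if "h \<in> keys u" "h' \<in> keys u" for h h'
    using even[OF that] odd[OF that] weyl_keys(1)[OF u(1) that(1)] weyl_keys(1)[OF u(1) that(2)]
    by (intro exp_eqI) auto
  moreover obtain g where g: "g \<in> keys u" using u(2) by (metis all_not_in_conv keys_eq_empty)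
  ultimately have "keys u \<subseteq> {g}" by auto
  from keys_subset_singleton_eq_single[OF this] obtain \<kappa> where ug: "u = single g \<kappa>" ..
  then have \<kappa>: "\<kappa> \<noteq> 0" using u(2) by auto
  have "lookup g (2 * k) = 0" if k: "k < n" for k
  proof -
    obtain w where w: "w \<in> weyl" "ty k \<odot> u = u \<odot> w"
      using normal_elemE[OF assms weyl.ty[OF k]] by blast
    define r where "r = inverse (q k - 1)"
    \<comment> \<open>\<open>w'\<close> is y_k conjugated by the monomial \<open>u\<close> in the
      torus. Cancelling \<open>u\<close> identifies it with \<open>w\<close>, which places it in the
      subalgebra.\<close>
    define w' where "w' = single (ez k - ex k) (r * c (ez k - ex k) g / c g (ez k - ex k))
      - single (- ex k) (r * c (- ex k) g / c g (- ex k))"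
    have "ty k \<odot> u = u \<odot> w'"
      by (simp add: ug ty_def w'_def r_def tmult_diff_left tmult_diff_right add.commute mult_ac)
    then have "u \<odot> (w - w') = 0" using w(2) by (simp add: tmult_diff_right)
    then have "w = w'" using u(2) by simp
    \<comment> \<open>Both monomials of \<open>w\<close> move 0 to the x-degree of
      \<open>- ex k\<close>, so vanishing at 0 says that their coefficients cancel, that is,
      \<open>c g (ez k) = 1\<close>.\<close>
    let ?F = "\<lambda>j. if \<forall>i<n. lookup j (2 * i) = lookup (- ex k) (2 * i) then 1 else 0 :: 'k"
    have "xneg ?F"
      using k by (intro xneg_indicator[of k] xdep_const) (auto simp: lookup_exp)
    from xneg_tact[OF w(1) this] have "tact w ?F 0 = 0" by (rule xneg_eq_0) simp
    then have "r * c (ez k - ex k) g / c g (ez k - ex k) = r * c (- ex k) g / c g (- ex k)"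
      by (simp add: \<open>w = w'\<close> w'_def tact_diff lookup_exp)
    moreover have "r \<noteq> 0" using q_neq_1[OF k] by (simp add: r_def)
    ultimately have "q k powi lookup g (2 * k) = 1"
      using k by (simp add: c_diff_left c_diff_right field_simps)
    then show ?thesis using q_powi_eq_1_iff k by blast
  qed
  then have "zexp g" using weyl_keys[OF u(1) g] by (intro zexpI) auto
  then show thesis using that ug \<kappa> by blast
qed

lemma normal_elem_tmult: "normal_elem u \<Longrightarrow> normal_elem v \<Longrightarrow> normal_elem (u \<odot> v)"
  unfolding normal_elem_def by (metis tmult_assoc tmult_eq_zero_iff weyl.tmult)

lemma normal_elem_scal: "\<kappa> \<noteq> 0 \<Longrightarrow> normal_elem (scal \<kappa>)"
  unfolding normal_elem_def by (metis scal_central weyl.scal lookup_single_eq lookup_zero)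

text \<open>Each generator commutes with z_k up to a scalar, and being carried past z_k into the
  subalgebra survives sums and products.\<close>

lemma normal_elem_tz:
  assumes "k < n"
  shows "normal_elem (tz k)"
proof -
  have "\<exists>b'\<in>weyl. b \<odot> tz k = tz k \<odot> b'" if "b \<in> weyl" for b
    using that
  proof (induction b rule: weyl.induct)
    case (tx l)
    then show ?case using tx_tz[OF tx assms] by (metis tmult_scal_right weyl.intros(1,3,5))
  next
    case (ty l)
    then show ?case using ty_tz[OF ty assms] by (metis tmult_scal_right weyl.intros(2,3,5))
  next
    case (scal \<kappa>)
    then show ?case using scal_central weyl.scal by metis
  next
    case (add u v)
    then show ?case by (metis tmult_add_left tmult_add_right weyl.add)
  next
    case (tmult u v)
    then show ?case by (metis tmult_assoc weyl.tmult)
  qed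
  moreover have "tz k \<noteq> 0" unfolding tz_def by (metis lookup_single_eq lookup_zero zero_neq_one)
  ultimately show ?thesis using tz_weyl[OF assms] by (simp add: normal_elem_def)
qed

text \<open>Induction on the total z-degree: one factor z_s is split off, and products of normal
  elements are normal.\<close>

lemma normal_elem_single:
  assumes "zexp g" "\<kappa> \<noteq> 0"
  shows "normal_elem (single g \<kappa>)"
  using assms
proof (induction "nat (\<Sum>k<n. lookup g (Suc (2 * k)))" arbitrary: g rule: less_induct)
  case less
  show ?case
  proof (cases "g = 0")
    case True
    then show ?thesis using normal_elem_scal less.prems by simp
  next
    case False
    then obtain s where s: "s < n" "lookup g (Suc (2 * s)) > 0" using zexp_nonzeroE less.prems by blast
    have le: "(\<Sum>k<n. lookup (g - ez s) (Suc (2 * k))) < (\<Sum>k<n. lookup g (Suc (2 * k)))"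
      using s by (intro sum_strict_mono_ex1) (auto simp: lookup_exp)
    moreover have z: "zexp (g - ez s)"
      using less.prems s by (intro zexpI) (auto simp: zexp_def lookup_exp)
    moreover have "(\<Sum>k<n. lookup (g - ez s) (Suc (2 * k))) \<ge> 0"
      using z by (intro sum_nonneg) (simp add: zexp_def)
    ultimately have "normal_elem (single (g - ez s) \<kappa>)" using less by simp
    then have "normal_elem (tz s \<odot> single (g - ez s) \<kappa>)"
      using normal_elem_tmult normal_elem_tz s by blast
    then show ?thesis by (simp add: tz_def)
  qed
qed

text \<open>Conjugation by z_l is diagonal on monomials, with eigenvalue q_l to the power of the
  x_l-exponent; here \<open>w\<close> lies in one eigenspace.\<close>

lemma tz_commute_keys:
  assumes "w \<odot> single (ez l) \<kappa> = scal e \<odot> (single (ez l) \<kappa> \<odot> w)" "\<kappa> \<noteq> 0" "l < n" "h \<in> keys w"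
  shows "q l powi lookup h (2 * l) = e"
proof -
  have "q l powi lookup h (2 * l) * lookup w h * \<kappa> = e * lookup w h * \<kappa>"
    using arg_cong[OF assms(1), of "\<lambda>f. lookup f (h + ez l)"] assms(3)
    by (simp add: lookup_tmult_single_left lookup_tmult_single_right mult_ac)
  then show ?thesis using assms(2,4) by (simp add: in_keys_iff)
qed

text \<open>The action on the constant function shows that \<open>\<gamma> z\<^sub>s - 1\<close> vanishes at \<open>z\<^sub>s = q\<^sub>s\<^sup>m\<close> for \<open>0 \<le> m < d\<close>,
  hence \<open>d = 1\<close> and \<open>\<gamma> = 1\<close>; comparing extreme exponents leaves only the trivial factorisation.\<close>

lemma factor_tz_minus_one:
  assumes "u \<in> weyl" "v \<in> weyl" "s < n" "d > 0" "\<kappa> \<noteq> 0" "\<gamma> \<noteq> 0"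
    and au: "\<And>h i. h \<in> keys u \<Longrightarrow> i < n \<Longrightarrow> lookup h (2 * i) = (if i = s then d else 0)"
    and av: "\<And>h i. h \<in> keys v \<Longrightarrow> i < n \<Longrightarrow> lookup h (2 * i) = (if i = s then - d else 0)"
    and eq: "v \<odot> u = scal \<kappa> \<odot> (scal \<gamma> \<odot> tz s - 1)"
  shows "d = 1 \<and> (\<exists>\<alpha> \<beta>. \<alpha> \<noteq> 0 \<and> \<beta> \<noteq> 0 \<and> u = scal \<alpha> \<odot> tx s \<and> v = scal \<beta> \<odot> ty s)"
proof -
  have eq': "v \<odot> u = single (ez s) (\<kappa> * \<gamma>) - scal \<kappa>"
    unfolding eq tz_def tmult_diff_right by simp
  have van: "\<gamma> * q s powi m = 1" if m: "0 \<le> m" "m < d" for m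
  proof -
    \<comment> \<open>\<open>j\<close> lies in the nonnegative orthant, while \<open>v\<close>
      lowers its x_s-exponent from m to the negative value m - d recorded in
      \<open>j'\<close>.\<close>
    define j :: "nat \<Rightarrow>\<^sub>0 int" where "j = single (2 * s) m"
    define j' :: "nat \<Rightarrow>\<^sub>0 int" where "j' = single (2 * s) (m - d)"
    have lj: "lookup j (2 * i) = (if i = s then m else 0)"
      "lookup j' (2 * i) = (if i = s then m - d else 0)" for i
      by (auto simp: j_def j'_def lookup_single when_def)
    let ?G = "tact u (\<lambda>_. 1)"
    \<comment> \<open>Every monomial of \<open>v\<close> reads at the x-degree of \<open>j'\<close>,
      so \<open>?G\<close> may be truncated there. The truncation is \<open>xneg\<close>, hence
      \<open>v\<close> sends it to a function vanishing at \<open>j\<close>.\<close>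
    let ?F = "\<lambda>k. if \<forall>i<n. lookup k (2 * i) = lookup j' (2 * i) then ?G k else 0"
    have "tact v ?G j = tact v ?F j"
    proof (rule tact_cong)
      fix h assume "h \<in> keys v"
      then have "\<forall>i<n. lookup (j + h) (2 * i) = lookup j' (2 * i)"
        using av by (simp add: lookup_add lj)
      then show "?G (j + h) = ?F (j + h)" by simp
    qed
    also have "xneg ?F"
      using m assms(3) by (intro xneg_indicator[of s] xdep_tact xdep_const) (auto simp: lj)
    from xneg_tact[OF assms(2) this] have "tact v ?F j = 0"
      by (rule xneg_eq_0) (use m in \<open>auto simp: lj\<close>)
    finally have "tact (v \<odot> u) (\<lambda>_. 1) j = 0" by (simp add: tact_tmult)
    \<comment> \<open>On the constant function, z_s evaluates at \<open>j\<close> to the scalar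
      q_s^m.\<close>
    then have "\<kappa> * (\<gamma> * q s powi m) = \<kappa> * 1"
      using assms(3) by (simp add: eq' tact_diff lj)
    then show ?thesis using assms(5) by (metis mult_left_cancel)
  qed
  have d: "d = 1"
  proof (rule ccontr)
    assume "d \<noteq> 1"
    \<comment> \<open>For d \<ge> 2 both m = 0 and m = 1 are allowed, giving \<gamma> = 1 and
      \<gamma> q_s = 1.\<close>
    then have "q s = 1" using van[of 0] van[of 1] assms(4) by simp
    then show False using q_neq_1 assms(3) by blast
  qed
  have \<gamma>: "\<gamma> = 1" using van[of 0] assms(4) by simp
  have eq'': "v \<odot> u = single (ez s) \<kappa> - scal \<kappa>" using eq' \<gamma> by simp
  have keys: "keys (v \<odot> u) = {0, ez s}"
    using assms(5) ez_pos[of s]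
    by (auto simp: eq'' in_keys_iff lookup_minus lookup_single when_def split: if_splits)
  then have nz: "u \<noteq> 0" "v \<noteq> 0" by auto
  have mx: "Max (keys v) + Max (keys u) = ez s"
    using Max_keys_tmult(1)[OF nz(2,1)] less_imp_le[OF ez_pos[of s]] by (simp add: keys max_def)
  have mn: "Min (keys v) + Min (keys u) = 0"
    using Min_keys_tmult[OF nz(2,1)] less_imp_le[OF ez_pos[of s]] by (simp add: keys min_def)
  have zu: "zexp (h - ex s)" if "h \<in> keys u" for h
    using au[OF that] weyl_keys[OF assms(1) that] d assms(3) by (intro zexpI) (auto simp: lookup_exp)
  have zv: "zexp (h + ex s)" if "h \<in> keys v" for h
    using av[OF that] weyl_keys[OF assms(2) that] d assms(3) by (intro zexpI) (auto simp: lookup_exp)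
  have in_keys: "Max (keys u) \<in> keys u" "Min (keys u) \<in> keys u" "Max (keys v) \<in> keys v" "Min (keys v) \<in> keys v"
    using nz by (simp_all add: Max_in Min_in)
  have zero: "g = 0 \<and> h = 0" if "zexp g" "zexp h" "g + h = 0" for g h
  proof -
    have "lookup g r = 0 \<and> lookup h r = 0" for r
      using that arg_cong[OF that(3), of "\<lambda>f. lookup f r"] unfolding zexp_def lookup_add
      by (smt (verit) lookup_zero)
    then show ?thesis by (metis poly_mapping_eqI lookup_zero)
  qed
  \<comment> \<open>After the shifts by \<open>ex s\<close> all exponents are nonnegative z-vectors;
    two of these with sum 0 are both 0.\<close>
  have "Min (keys u) - ex s = 0 \<and> Min (keys v) + ex s = 0"
    using mn by (intro zero zu zv in_keys) (simp add: algebra_simps)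
  then have Min: "Min (keys u) = ex s" "Min (keys v) = - ex s"
    by (simp_all add: eq_neg_iff_add_eq_0)
  have "Max (keys u) - ex s = 0 \<or> Max (keys v) + ex s = 0"
    using mx by (intro zexp_add_eq_ez[of _ _ s] zu zv in_keys) (simp add: algebra_simps)
  \<comment> \<open>Here \<open>v\<close> would be a multiple of the monomial with exponent
    \<open>- ex s\<close>, which sends an \<open>xneg\<close> function to one that is nonzero at 0
    and so is outside the subalgebra.\<close>
  moreover have False if "Max (keys v) + ex s = 0"
  proof -
    have v: "v = single (- ex s) (lookup v (- ex s))"
      using that Min by (intro Max_eq_Min_keys_imp_single) (simp_all add: eq_neg_iff_add_eq_0)
    let ?F = "\<lambda>j. if \<forall>i<n. lookup j (2 * i) = lookup (- ex s) (2 * i) then 1 else 0 :: 'k"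
    have "xneg ?F"
      using assms(3) by (intro xneg_indicator[of s] xdep_const) (auto simp: lookup_exp)
    from xneg_tact[OF assms(2) this] have "tact v ?F 0 = 0" by (rule xneg_eq_0) simp
    moreover have "tact v ?F 0 = lookup v (- ex s)" by (subst v) simp
    ultimately show False using v nz(2) by simp
  qed
  ultimately have "Max (keys u) = ex s" by auto
  then have u: "u = single (ex s) (lookup u (ex s))"
    using Min by (intro Max_eq_Min_keys_imp_single)
  define \<alpha> where "\<alpha> = lookup u (ex s)"
  have \<alpha>: "u = scal \<alpha> \<odot> tx s" "\<alpha> \<noteq> 0"
    using u nz(1) by (auto simp: \<alpha>_def tx_def)
  \<comment> \<open>Chosen so that \<beta> y_s \<open>u\<close> equals \<kappa> (z_s - 1), which is
    \<open>v \<odot> u\<close>; cancelling \<open>u\<close> then determines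
    \<open>v\<close>.\<close>
  define \<beta> where "\<beta> = \<kappa> * (q s - 1) / \<alpha>"
  have "\<beta> \<noteq> 0" using \<alpha> assms(5) q_neq_1[OF assms(3)] by (simp add: \<beta>_def)
  have "(scal \<beta> \<odot> ty s) \<odot> u = scal (\<beta> * \<alpha>) \<odot> (ty s \<odot> tx s)"
    by (simp only: \<alpha> scal_tmult_scal)
  also have "\<dots> = scal \<kappa> \<odot> (tz s - 1)"
  proof -
    have "\<beta> * \<alpha> * inverse (q s - 1) = \<kappa>"
      using \<alpha>(2) q_neq_1[OF assms(3)] by (simp add: \<beta>_def field_simps)
    then show ?thesis by (simp only: ty_tx[OF assms(3)] scal_scal)
  qed
  also have "\<dots> = v \<odot> u" by (simp add: eq'' tz_def tmult_diff_right)
  finally have "(v - scal \<beta> \<odot> ty s) \<odot> u = 0" by (simp add: tmult_diff_left)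
  then have "v = scal \<beta> \<odot> ty s" using nz(1) by simp
  then show ?thesis using d \<alpha> \<open>\<beta> \<noteq> 0\<close> by blast
qed

end

section \<open>Automorphisms\<close>

text \<open>An automorphism of the subalgebra, encoded as a total function on the torus that is
  constrained only on \<open>weyl\<close>.\<close>

locale qweyl_aut = qweyl n q \<Lambda> for n and q :: "nat \<Rightarrow> 'k::field" and \<Lambda> +
  fixes \<psi> :: "((nat \<Rightarrow>\<^sub>0 int) \<Rightarrow>\<^sub>0 'k) \<Rightarrow> ((nat \<Rightarrow>\<^sub>0 int) \<Rightarrow>\<^sub>0 'k)"
  assumes \<psi>_weyl: "u \<in> weyl \<Longrightarrow> \<psi> u \<in> weyl"
    and \<psi>_add: "u \<in> weyl \<Longrightarrow> v \<in> weyl \<Longrightarrow> \<psi> (u + v) = \<psi> u + \<psi> v"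
    and \<psi>_tmult: "u \<in> weyl \<Longrightarrow> v \<in> weyl \<Longrightarrow> \<psi> (tmult u v) = tmult (\<psi> u) (\<psi> v)"
    and \<psi>_scal: "\<psi> (scal \<kappa>) = scal \<kappa>"
    and \<psi>_inj: "u \<in> weyl \<Longrightarrow> v \<in> weyl \<Longrightarrow> \<psi> u = \<psi> v \<Longrightarrow> u = v"
    and \<psi>_surj: "v \<in> weyl \<Longrightarrow> \<exists>u\<in>weyl. \<psi> u = v"
begin

notation tmult (infixl "\<odot>" 70)

lemma \<psi>_diff: "u \<in> weyl \<Longrightarrow> v \<in> weyl \<Longrightarrow> \<psi> (u - v) = \<psi> u - \<psi> v"
  using \<psi>_add[of "u - v" v] by (simp add: weyl_diff algebra_simps)

lemma \<psi>_one: "\<psi> 1 = 1"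
  using \<psi>_scal[of 1] by simp

lemma \<psi>_scal_tmult: "u \<in> weyl \<Longrightarrow> \<psi> (scal \<kappa> \<odot> u) = scal \<kappa> \<odot> \<psi> u"
  by (simp add: \<psi>_tmult \<psi>_scal weyl.scal)

lemma \<psi>_eq_scal: "u \<in> weyl \<Longrightarrow> \<psi> u = scal \<kappa> \<Longrightarrow> u = scal \<kappa>"
  using \<psi>_inj[of u "scal \<kappa>"] by (simp add: \<psi>_scal weyl.scal)

lemma \<psi>_nonzero: "u \<in> weyl \<Longrightarrow> u \<noteq> 0 \<Longrightarrow> \<psi> u \<noteq> 0"
  using \<psi>_eq_scal[of u 0] by auto

text \<open>The witnesses \<open>b'\<close> are transported in both directions through preimages
  under \<open>\<psi>\<close>.\<close>

lemma normal_elem_\<psi>: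
  assumes "u \<in> weyl"
  shows "normal_elem (\<psi> u) \<longleftrightarrow> normal_elem u"
proof
  assume *: "normal_elem (\<psi> u)"
  have "\<exists>b'\<in>weyl. b \<odot> u = u \<odot> b'" if "b \<in> weyl" for b
  proof -
    obtain v where "v \<in> weyl" "\<psi> b \<odot> \<psi> u = \<psi> u \<odot> v"
      using normal_elemE[OF *] \<psi>_weyl \<open>b \<in> weyl\<close> by metis
    moreover from this obtain b' where "b' \<in> weyl" "\<psi> b' = v" using \<psi>_surj by blast
    ultimately have "\<psi> (b \<odot> u) = \<psi> (u \<odot> b')" using assms that by (simp add: \<psi>_tmult)
    then have "b \<odot> u = u \<odot> b'" using \<psi>_inj assms that \<open>b' \<in> weyl\<close> weyl.tmult by metis
    then show ?thesis using \<open>b' \<in> weyl\<close> by blast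
  qed
  moreover have "u \<noteq> 0" using * \<psi>_scal[of 0] by (auto simp: normal_elem_def)
  ultimately show "normal_elem u" using assms by (simp add: normal_elem_def)
next
  assume *: "normal_elem u"
  have "\<exists>b'\<in>weyl. b \<odot> \<psi> u = \<psi> u \<odot> b'" if b: "b \<in> weyl" for b
  proof -
    obtain a where a: "a \<in> weyl" "\<psi> a = b" using \<psi>_surj b by blast
    obtain a' where "a' \<in> weyl" "a \<odot> u = u \<odot> a'" using normal_elemE[OF * a(1)] .
    then show ?thesis using a assms \<psi>_tmult \<psi>_weyl by metis
  qed
  then show "normal_elem (\<psi> u)"
    using assms * \<psi>_weyl \<psi>_nonzero by (simp add: normal_elem_def)
qed

text \<open>\<open>z\<^sub>k\<close> is irreducible in the monoid of normal elements, hence so is its image.\<close>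

lemma \<psi>_tz:
  assumes "k < n"
  obtains s \<kappa> where "s < n" "\<kappa> \<noteq> 0" "\<psi> (tz k) = single (ez s) \<kappa>"
proof -
  have ez_neq: "ez s \<noteq> 0" for s using ez_pos[of s] by simp
  have not_scal: "tz s \<noteq> scal \<kappa>" for s \<kappa>
  proof
    assume "tz s = scal \<kappa>"
    then have "lookup (tz s) (ez s) = lookup (scal \<kappa>) (ez s)" by simp
    then show False using ez_neq by (simp add: tz_def lookup_single when_def)
  qed
  obtain g \<kappa> where g: "\<psi> (tz k) = single g \<kappa>" "\<kappa> \<noteq> 0" "zexp g"
    using normal_elem_imp_single normal_elem_\<psi> normal_elem_tz[OF assms] tz_weyl[OF assms] by metis
  have "g \<noteq> 0"
    using g(1) \<psi>_eq_scal[OF tz_weyl[OF assms]] not_scal by blast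
  then obtain s where s: "s < n" "lookup g (Suc (2 * s)) > 0" using zexp_nonzeroE g(3) by blast
  \<comment> \<open>Some z_s divides the image. Pulling both factors back writes z_k as a product of
    two normal elements.\<close>
  have "zexp (g - ez s)"
    using g(3) s by (intro zexpI) (auto simp: zexp_def lookup_exp)
  then have nh: "normal_elem (single (g - ez s) \<kappa>)" using normal_elem_single g(2) by blast
  then obtain v where v: "v \<in> weyl" "\<psi> v = single (g - ez s) \<kappa>"
    using \<psi>_surj normal_elem_def by metis
  obtain u where u: "u \<in> weyl" "\<psi> u = tz s" using \<psi>_surj tz_weyl[OF s(1)] by blast
  have "\<psi> (u \<odot> v) = \<psi> (tz k)" using u v g(1) by (simp add: \<psi>_tmult tz_def)
  then have uv: "u \<odot> v = tz k" using \<psi>_inj u(1) v(1) tz_weyl[OF assms] weyl.tmult by metis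
  obtain g1 \<kappa>1 where g1: "u = single g1 \<kappa>1" "\<kappa>1 \<noteq> 0" "zexp g1"
    using normal_elem_imp_single normal_elem_\<psi>[OF u(1)] u(2) normal_elem_tz[OF s(1)] by metis
  obtain g2 \<kappa>2 where g2: "v = single g2 \<kappa>2" "\<kappa>2 \<noteq> 0" "zexp g2"
    using normal_elem_imp_single normal_elem_\<psi>[OF v(1)] v(2) nh by metis
  have "keys (u \<odot> v) = {g1 + g2}" using g1 g2 by simp
  then have "g1 + g2 = ez k" using uv by (simp add: tz_def)
  then have "g1 = 0 \<or> g2 = 0" using zexp_add_eq_ez g1(3) g2(3) by blast
  \<comment> \<open>The factor \<open>u\<close> is not scalar because its image is z_s, so
    irreducibility makes \<open>v\<close> scalar.\<close>
  moreover have "g1 \<noteq> 0" using g1(1) u(2) \<psi>_scal not_scal by metis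
  ultimately have "single (g - ez s) \<kappa> = scal \<kappa>2" using g2(1) v(2) \<psi>_scal by metis
  then have "keys (single (g - ez s) \<kappa>) = keys (scal \<kappa>2)" by simp
  then have "g = ez s" using g(2) by (auto split: if_splits)
  then show thesis using that[OF s(1) g(2)] g(1) by blast
qed

theorem qweyl_aut_classification:
  "\<exists>\<sigma> \<alpha>. \<sigma> permutes {..<n} \<and> (\<forall>i<n. \<alpha> i \<noteq> 0 \<and>
     ((\<psi> (tx i) = scal (\<alpha> i) \<odot> tx (\<sigma> i) \<and> \<psi> (ty i) = scal (inverse (\<alpha> i)) \<odot> ty (\<sigma> i)
        \<and> q i = q (\<sigma> i))
    \<or> (\<psi> (tx i) = scal (\<alpha> i) \<odot> ty (\<sigma> i)
        \<and> \<psi> (ty i) = scal (- (inverse (q i) * inverse (\<alpha> i))) \<odot> tx (\<sigma> i)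
        \<and> q i = inverse (q (\<sigma> i)))))"
proof -
  have "\<exists>s \<kappa>. s < n \<and> \<kappa> \<noteq> 0 \<and> \<psi> (tz k) = single (ez s) \<kappa>" if "k < n" for k
    using \<psi>_tz[OF that] by metis
  then obtain s \<kappa> where s: "\<And>k. k < n \<Longrightarrow> s k < n" and \<kappa>: "\<And>k. k < n \<Longrightarrow> \<kappa> k \<noteq> 0"
    and tz: "\<And>k. k < n \<Longrightarrow> \<psi> (tz k) = single (ez (s k)) (\<kappa> k)"
    by metis
  \<comment> \<open>Two indices with the same value would make z_k and z_l proportional.\<close>
  have inj: "inj_on s {..<n}"
  proof (rule inj_onI)
    fix k l assume "k \<in> {..<n}" "l \<in> {..<n}" and e: "s k = s l"
    then have kl: "k < n" "l < n" by auto
    have "\<psi> (scal (\<kappa> k) \<odot> tz l) = \<psi> (scal (\<kappa> l) \<odot> tz k)"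
      using kl by (simp add: \<psi>_scal_tmult tz_weyl tz e mult.commute)
    then have eq: "scal (\<kappa> k) \<odot> tz l = scal (\<kappa> l) \<odot> tz k"
      using \<psi>_inj kl tz_weyl weyl.scal weyl.tmult by metis
    then have "keys (scal (\<kappa> k) \<odot> tz l) = keys (scal (\<kappa> l) \<odot> tz k)" by simp
    then show "k = l" using \<kappa>[OF kl(1)] \<kappa>[OF kl(2)] by (simp add: tz_def)
  qed
  define \<sigma> where "\<sigma> k = (if k < n then s k else k)" for k
  have surj: "s ` {..<n} = {..<n}"
    using inj s by (intro endo_inj_surj) auto
  have bij: "bij_betw \<sigma> {..<n} {..<n}"
    unfolding bij_betw_def using inj surj by (auto simp: \<sigma>_def inj_on_def image_def)
  have perm: "\<sigma> permutes {..<n}"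
    using bij by (rule bij_imp_permutes) (simp add: \<sigma>_def)
  have main: "\<exists>\<alpha>. \<alpha> \<noteq> 0 \<and>
     ((\<psi> (tx i) = scal \<alpha> \<odot> tx (s i) \<and> \<psi> (ty i) = scal (inverse \<alpha>) \<odot> ty (s i) \<and> q i = q (s i))
    \<or> (\<psi> (tx i) = scal \<alpha> \<odot> ty (s i) \<and> \<psi> (ty i) = scal (- (inverse (q i) * inverse \<alpha>)) \<odot> tx (s i)
        \<and> q i = inverse (q (s i))))" if i: "i < n" for i
  proof -
    have si: "s i < n" using s i by blast
    \<comment> \<open>The scalars by which \<open>w\<close> commutes with the z_j pass to the
      images. Since every z_l is the image of some z_j up to a scalar, they fix the x-exponents of
      every monomial of \<open>\<psi> w\<close> through powers of q_l.\<close>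
    have ev: "q l powi lookup h (2 * l) = (if l = s i then e else 1)"
      if w: "w \<in> weyl" and h: "h \<in> keys (\<psi> w)" and l: "l < n"
        and com: "\<And>j. j < n \<Longrightarrow> w \<odot> tz j = scal (if i = j then e else 1) \<odot> (tz j \<odot> w)" for w h l e
    proof -
      obtain j where j: "j < n" "l = s j" using surj l by auto
      have "(i = j) = (l = s i)" using j i inj by (auto simp: inj_on_def)
      moreover have "\<psi> (w \<odot> tz j) = \<psi> (scal (if i = j then e else 1) \<odot> (tz j \<odot> w))"
        using com[OF j(1)] by simp
      then have "\<psi> w \<odot> \<psi> (tz j) = scal (if i = j then e else 1) \<odot> (\<psi> (tz j) \<odot> \<psi> w)"
        by (simp only: \<psi>_tmult \<psi>_scal_tmult w tz_weyl[OF j(1)] weyl.tmult)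
      ultimately show ?thesis
        using tz_commute_keys[of "\<psi> w" l "\<kappa> j" "if l = s i then e else 1" h] \<kappa>[OF j(1)] l h j
        by (simp add: tz)
    qed
    let ?u = "\<psi> (tx i)" and ?v = "\<psi> (ty i)"
    have tw: "tx i \<in> weyl" "ty i \<in> weyl" "tz i \<in> weyl" using i tz_weyl weyl.intros by blast+
    then have uv: "?u \<in> weyl" "?v \<in> weyl" using \<psi>_weyl by blast+
    have evu: "q l powi lookup h (2 * l) = (if l = s i then q i else 1)" if "h \<in> keys ?u" "l < n" for h l
      using that tx_tz[OF i] tw by (intro ev) auto
    have evv: "q l powi lookup h (2 * l) = (if l = s i then inverse (q i) else 1)" if "h \<in> keys ?v" "l < n" for h l
      using that ty_tz[OF i] tw by (intro ev) auto
    have "tx i \<noteq> 0" unfolding tx_def by (metis lookup_single_eq lookup_zero zero_neq_one)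
    then have "?u \<noteq> 0" using \<psi>_nonzero tw by blast
    then obtain h0 where h0: "h0 \<in> keys ?u" by (metis all_not_in_conv keys_eq_empty)
    \<comment> \<open>The degree is read off one monomial of the image of x_i. As q_(s i) is not a
      root of unity, all monomials of that image share it, and those of the image of y_i have its
      negative.\<close>
    define d where "d = lookup h0 (2 * s i)"
    have qd: "q (s i) powi d = q i" using evu[OF h0 si] by (simp add: d_def)
    have au: "lookup h (2 * l) = (if l = s i then d else 0)" if "h \<in> keys ?u" "l < n" for h l
      using evu[OF that] qd q_powi_inject[OF si, of "lookup h (2 * l)" d] q_powi_eq_1_iff[OF that(2)]
      by (auto split: if_splits)
    have av: "lookup h (2 * l) = (if l = s i then - d else 0)" if "h \<in> keys ?v" "l < n" for h l
      using evv[OF that] qd q_powi_inject[OF si, of "lookup h (2 * l)" "- d"] q_powi_eq_1_iff[OF that(2)]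
      by (auto split: if_splits simp: power_int_minus)
    let ?r = "inverse (q i - 1)"
    have r: "?r \<noteq> 0" using q_neq_1[OF i] by simp
    have vu: "?v \<odot> ?u = scal ?r \<odot> (scal (\<kappa> i) \<odot> tz (s i) - 1)"
      using arg_cong[OF ty_tx[OF i], of \<psi>] i tw weyl_one
      by (simp add: \<psi>_tmult \<psi>_scal_tmult \<psi>_diff weyl_diff \<psi>_one tz) (simp add: tz_def)
    have uv': "?u \<odot> ?v = scal ?r \<odot> (scal (q i * \<kappa> i) \<odot> tz (s i) - 1)"
      using arg_cong[OF tx_ty[OF i], of \<psi>] i tw weyl_one weyl.scal weyl.tmult
      by (simp add: \<psi>_tmult \<psi>_scal_tmult \<psi>_diff weyl_diff \<psi>_one \<psi>_scal tz) (simp add: tz_def)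
    have rel: "?u \<odot> ?v - scal (q i) \<odot> (?v \<odot> ?u) = 1"
      using arg_cong[OF weyl_rel[OF i], of \<psi>] tw
      by (simp add: \<psi>_tmult \<psi>_scal_tmult \<psi>_diff weyl.tmult weyl.scal \<psi>_one \<psi>_scal)
    have rel': "tx (s i) \<odot> ty (s i) = 1 + scal (q (s i)) \<odot> (ty (s i) \<odot> tx (s i))"
      using weyl_rel[OF si] by (simp add: algebra_simps)
    have one_eq: "a = 1" if "scal a = 1" for a
      using that by (metis lookup_single_eq lookup_one_zero)
    have "d \<noteq> 0" using qd q_neq_1[OF i] by auto
    then consider "d > 0" | "d < 0" by linarith
    then show ?thesis
    proof cases
      case 1
      obtain \<alpha> \<beta> where ab: "d = 1" "\<alpha> \<noteq> 0" "\<beta> \<noteq> 0" "?u = scal \<alpha> \<odot> tx (s i)" "?v = scal \<beta> \<odot> ty (s i)"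
        using factor_tz_minus_one[OF uv si 1 r \<kappa>[OF i] au av vu] by blast
      have qq: "q i = q (s i)" using qd ab(1) by simp
      \<comment> \<open>The image of the relation x_i y_i - q_i y_i x_i = 1 normalises the two
        scalars.\<close>
      have "scal (\<alpha> * \<beta>) = 1"
        using rel unfolding ab(4,5) scal_tmult_scal rel'
        by (simp add: tmult_add_right scal_scal qq mult_ac)
      then have "\<alpha> * \<beta> = 1" by (rule one_eq)
      then have "\<beta> = inverse \<alpha>" by (metis inverse_unique)
      then show ?thesis using ab qq by blast
    next
      case 2
      have d: "- d > 0" using 2 by simp
      \<comment> \<open>The images of x_i and y_i exchange roles, with the product in the order of
        \<open>uv'\<close>; hence the coefficient of z is now
        \<open>q i * \<kappa> i\<close>.\<close>
      have "q i * \<kappa> i \<noteq> 0" using \<kappa>[OF i] q_nz[OF i] by simp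
      moreover have "lookup h (2 * l) = (if l = s i then - (- d) else 0)"
        if "h \<in> keys ?u" "l < n" for h l
        using au[OF that] by simp
      ultimately obtain \<alpha> \<beta> where ab: "- d = 1" "\<alpha> \<noteq> 0" "\<beta> \<noteq> 0"
          "?v = scal \<alpha> \<odot> tx (s i)" "?u = scal \<beta> \<odot> ty (s i)"
        using factor_tz_minus_one[OF uv(2,1) si d r _ av _ uv'] by blast
      have "d = - 1" using ab(1) by simp
      then have qq: "q i = inverse (q (s i))" using qd by (simp add: power_int_minus)
      have "q i * q (s i) = 1" using qq q_nz[OF si] by simp
      \<comment> \<open>Because q_i q_(s i) = 1, the y x terms of the relation cancel and the
        constant term gives - q_i \<alpha> \<beta> = 1.\<close>
      then have coeff: "q i * (\<alpha> * (\<beta> * q (s i))) = \<beta> * \<alpha>"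
        by (simp add: mult_ac flip: mult.assoc[of "q i" "q (s i)"])
      have "scal (- (q i * \<alpha> * \<beta>)) = 1"
        using rel unfolding ab(4,5) scal_tmult_scal rel'
        by (simp add: tmult_add_right scal_scal coeff single_uminus mult.assoc)
      then have "- (q i * \<alpha> * \<beta>) = 1" by (rule one_eq)
      then have "\<alpha> = - (inverse (q i) * inverse \<beta>)"
        using ab(3) q_nz[OF i] by (simp add: field_simps) (metis minus_minus mult.commute)
      then show ?thesis using ab qq by blast
    qed
  qed
  then obtain \<alpha> where "\<And>i. i < n \<Longrightarrow> \<alpha> i \<noteq> 0 \<and>
     ((\<psi> (tx i) = scal (\<alpha> i) \<odot> tx (s i) \<and> \<psi> (ty i) = scal (inverse (\<alpha> i)) \<odot> ty (s i) \<and> q i = q (s i))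
    \<or> (\<psi> (tx i) = scal (\<alpha> i) \<odot> ty (s i) \<and> \<psi> (ty i) = scal (- (inverse (q i) * inverse (\<alpha> i))) \<odot> tx (s i)
        \<and> q i = inverse (q (s i))))"
    by metis
  then show ?thesis using perm by (intro exI[of _ \<sigma>] exI[of _ \<alpha>]) (simp add: \<sigma>_def)
qed

end

section \<open>The free algebra and its quotient\<close>

definition fa_word :: "gen list \<Rightarrow> 'k::field fa" where
  "fa_word w = (\<lambda>v. if v = w then 1 else 0)"

definition supp :: "'k::field fa \<Rightarrow> gen list set" where
  "supp f = {w. f w \<noteq> 0}"

lemmas fa_simps = fa_add_def fa_sub_def fa_smult_def fa_zero_def

lemma FA_iff: "f \<in> FA n \<longleftrightarrow> finite (supp f) \<and> (\<forall>w\<in>supp f. \<forall>a\<in>set w. fst a < n)"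
  by (auto simp: FA_def supp_def)

lemma FA_subset:
  assumes "supp f \<subseteq> S" "finite S" "\<And>w a. w \<in> S \<Longrightarrow> a \<in> set w \<Longrightarrow> fst a < n"
  shows "f \<in> FA n"
  using assms finite_subset by (fastforce simp: FA_iff)

lemma FA_add: "f \<in> FA n \<Longrightarrow> g \<in> FA n \<Longrightarrow> fa_add f g \<in> FA n"
  by (rule FA_subset[of _ "supp f \<union> supp g"]) (auto simp: FA_iff supp_def fa_simps)

lemma FA_sub: "f \<in> FA n \<Longrightarrow> g \<in> FA n \<Longrightarrow> fa_sub f g \<in> FA n"
  by (rule FA_subset[of _ "supp f \<union> supp g"]) (auto simp: FA_iff supp_def fa_simps)

lemma FA_smult: "f \<in> FA n \<Longrightarrow> fa_smult \<kappa> f \<in> FA n"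
  by (rule FA_subset[of _ "supp f"]) (auto simp: FA_iff supp_def fa_simps)

lemma FA_zero: "fa_zero \<in> FA n"
  by (simp add: FA_def fa_simps)

lemma FA_word: "(\<And>a. a \<in> set w \<Longrightarrow> fst a < n) \<Longrightarrow> fa_word w \<in> FA n"
  by (rule FA_subset[of _ "{w}"]) (auto simp: supp_def fa_word_def)

lemma supp_fa_mult: "supp (fa_mult f g) \<subseteq> (\<lambda>(u, v). u @ v) ` (supp f \<times> supp g)"
proof
  fix w assume "w \<in> supp (fa_mult f g)"
  then obtain k where "f (take k w) * g (drop k w) \<noteq> 0"
    unfolding supp_def fa_mult_def by (metis (mono_tags, lifting) mem_Collect_eq sum.neutral)
  then have "(take k w, drop k w) \<in> supp f \<times> supp g" by (auto simp: supp_def)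
  then show "w \<in> (\<lambda>(u, v). u @ v) ` (supp f \<times> supp g)"
    by (rule rev_image_eqI) simp
qed

lemma FA_mult: "f \<in> FA n \<Longrightarrow> g \<in> FA n \<Longrightarrow> fa_mult f g \<in> FA n"
  by (rule FA_subset[OF supp_fa_mult]) (fastforce simp: FA_iff)+

lemma fa_one_eq_word: "fa_one = fa_word []"
  by (simp add: fa_one_def fa_word_def)

lemma fa_gen_eq_word: "fa_gen a = fa_word [a]"
  by (simp add: fa_gen_def fa_word_def)

lemma FA_one: "fa_one \<in> FA n"
  unfolding fa_one_eq_word by (rule FA_word) simp

lemma FA_X: "i < n \<Longrightarrow> X i \<in> FA n" and FA_Y: "i < n \<Longrightarrow> Y i \<in> FA n"
  unfolding X_def Y_def fa_gen_eq_word by (auto intro: FA_word)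

text \<open>Only the cut at position \<open>length u\<close> contributes to the convolution.\<close>

lemma fa_mult_word: "fa_mult (fa_word u) (fa_word v) = (fa_word (u @ v) :: 'k::field fa)"
proof
  fix w
  have "fa_mult (fa_word u) (fa_word v) w
      = (\<Sum>k\<in>{0..length w}. if k = length u then if w = u @ v then 1 else 0 else (0 :: 'k))"
    unfolding fa_mult_def
  proof (rule sum.cong)
    fix k assume "k \<in> {0..length w}"
    then have *: "take k w = u \<and> drop k w = v \<longleftrightarrow> k = length u \<and> w = u @ v"
      by auto
    have "fa_word u (take k w) * fa_word v (drop k w)
        = (if take k w = u \<and> drop k w = v then 1 else 0 :: 'k)"
      by (simp add: fa_word_def)
    then show "fa_word u (take k w) * fa_word v (drop k w)
        = (if k = length u then if w = u @ v then 1 else 0 else 0 :: 'k)"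
      unfolding * by simp
  qed simp
  also have "\<dots> = fa_word (u @ v) w"
    by (simp add: fa_word_def)
  finally show "fa_mult (fa_word u) (fa_word v) w = (fa_word (u @ v) w :: 'k)" .
qed

lemma fa_mult_add_left: "fa_mult (fa_add f g) h = fa_add (fa_mult f h) (fa_mult g h)"
  and fa_mult_add_right: "fa_mult h (fa_add f g) = fa_add (fa_mult h f) (fa_mult h g)"
  and fa_mult_sub_left: "fa_mult (fa_sub f g) h = fa_sub (fa_mult f h) (fa_mult g h)"
  and fa_mult_sub_right: "fa_mult h (fa_sub f g) = fa_sub (fa_mult h f) (fa_mult h g)"
  and fa_mult_smult_left: "fa_mult (fa_smult \<kappa> f) h = fa_smult \<kappa> (fa_mult f h)"
  and fa_mult_smult_right: "fa_mult h (fa_smult \<kappa> f) = fa_smult \<kappa> (fa_mult h f)"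
  by (simp_all add: fa_mult_def fa_simps sum.distrib sum_subtractf sum_distrib_left algebra_simps)

lemma fa_one_mult: "fa_mult fa_one f = f"
proof
  fix w
  have "fa_mult fa_one f w = (\<Sum>k\<in>{0..length w}. if k = 0 then f w else 0)"
    unfolding fa_mult_def by (rule sum.cong) (auto simp: fa_one_def)
  then show "fa_mult fa_one f w = f w" by simp
qed

lemma fa_mult_one: "fa_mult f fa_one = f"
proof
  fix w
  have "fa_mult f fa_one w = (\<Sum>k\<in>{0..length w}. if k = length w then f w else 0)"
    unfolding fa_mult_def by (rule sum.cong) (auto simp: fa_one_def)
  then show "fa_mult f fa_one w = f w" by simp
qed

text \<open>One word of the support is split off at a time; linear and bilinear statements thereby
  reduce to words.\<close>

lemma FA_induct [consumes 1, case_names zero add word]: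
  assumes f: "f \<in> FA n"
    and zero: "P fa_zero"
    and add: "\<And>f g. f \<in> FA n \<Longrightarrow> g \<in> FA n \<Longrightarrow> P f \<Longrightarrow> P g \<Longrightarrow> P (fa_add f g)"
    and word: "\<And>\<kappa> w. (\<And>a. a \<in> set w \<Longrightarrow> fst a < n) \<Longrightarrow> P (fa_smult \<kappa> (fa_word w))"
  shows "P f"
proof -
  have "P (\<lambda>w. if w \<in> S then f w else 0)" if "finite S" "S \<subseteq> supp f" for S
    using that
  proof (induction S rule: finite_induct)
    case empty
    then show ?case using zero by (simp add: fa_zero_def)
  next
    case (insert w S)
    have w: "fst a < n" if "a \<in> set w" for a
      using insert.prems f that by (auto simp: FA_iff)
    have "(\<lambda>v. if v \<in> insert w S then f v else 0)
        = fa_add (fa_smult (f w) (fa_word w)) (\<lambda>v. if v \<in> S then f v else 0)"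
      using insert.hyps by (auto simp: fa_simps fa_word_def)
    moreover have "(\<lambda>v. if v \<in> S then f v else 0) \<in> FA n"
      using f by (intro FA_subset[of _ "supp f"]) (auto simp: FA_iff supp_def)
    ultimately show ?case
      using insert w by (simp add: add word FA_smult FA_word)
  qed
  moreover have "(\<lambda>w. if w \<in> supp f then f w else 0) = f"
    by (auto simp: supp_def)
  ultimately show ?thesis using f by (metis FA_iff order_refl)
qed

subsection \<open>The defining ideal\<close>

lemma rels_FA: "r \<in> rels n q \<Lambda> \<Longrightarrow> r \<in> FA n"
  unfolding rels_def by (auto intro!: FA_sub FA_smult FA_mult FA_X FA_Y FA_one)

lemma ideal_FA: "r \<in> rel_ideal n q \<Lambda> \<Longrightarrow> r \<in> FA n"
  by (induction r rule: rel_ideal.induct) (auto intro: rels_FA FA_zero FA_add FA_mult)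

text \<open>Scaling is two-sided multiplication by the constant \<kappa> and by 1, both in
  \<open>FA n\<close>.\<close>

lemma ideal_smult:
  assumes "r \<in> rel_ideal n q \<Lambda>"
  shows "fa_smult \<kappa> r \<in> rel_ideal n q \<Lambda>"
  using rel_ideal.mult[OF assms FA_smult[OF FA_one, of \<kappa>] FA_one]
  by (simp add: fa_mult_smult_left fa_one_mult fa_mult_one)

lemma eqA_refl: "eqA n q \<Lambda> f f"
  using rel_ideal.zero by (simp add: eqA_def fa_simps)

lemma eqA_trans:
  assumes "eqA n q \<Lambda> f g" "eqA n q \<Lambda> g h"
  shows "eqA n q \<Lambda> f h"
  using rel_ideal.add[OF assms[unfolded eqA_def]] by (simp add: eqA_def fa_simps)

lemma eqA_add:
  assumes "eqA n q \<Lambda> f g" "eqA n q \<Lambda> f' g'"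
  shows "eqA n q \<Lambda> (fa_add f f') (fa_add g g')"
  using rel_ideal.add[OF assms[unfolded eqA_def]] by (simp add: eqA_def fa_simps algebra_simps)

lemma eqA_smult:
  assumes "eqA n q \<Lambda> f g"
  shows "eqA n q \<Lambda> (fa_smult \<kappa> f) (fa_smult \<kappa> g)"
  using ideal_smult[OF assms[unfolded eqA_def], of \<kappa>] by (simp add: eqA_def fa_simps algebra_simps)

subsection \<open>Sorted words span the quotient\<close>

text \<open>Orders the generators as y_0 < x_0 < y_1 < x_1 < ..., so that sorted words are the
  ordered (PBW) monomials.\<close>

definition gkey :: "gen \<Rightarrow> nat" where
  "gkey a = 2 * fst a + (if snd a then 1 else 0)"

lemma inj_gkey: "inj gkey"
  by (rule injI) (auto simp: gkey_def prod_eq_iff split: if_splits; presburger)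

definition sorted_comb :: "nat \<Rightarrow> 'k::field fa set" where
  "sorted_comb n = {f \<in> FA n. \<forall>w\<in>supp f. sorted (map gkey w)}"

lemma sorted_comb_add: "f \<in> sorted_comb n \<Longrightarrow> g \<in> sorted_comb n \<Longrightarrow> fa_add f g \<in> sorted_comb n"
  by (auto simp: sorted_comb_def FA_add) (fastforce simp: supp_def fa_simps)

lemma sorted_comb_smult: "f \<in> sorted_comb n \<Longrightarrow> fa_smult \<kappa> f \<in> sorted_comb n"
  by (auto simp: sorted_comb_def FA_smult) (auto simp: supp_def fa_simps)

lemma not_sorted_map_decomp:
  fixes f :: "'a \<Rightarrow> 'b::linorder"
  assumes "\<not> sorted (map f w)"
  obtains u a b v where "w = u @ a # b # v" "f b < f a"
proof -
  have "\<exists>u a b v. w = u @ a # b # v \<and> f b < f a"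
    using assms
  proof (induction w)
    case (Cons a w)
    show ?case
    proof (cases "sorted (map f w)")
      case True
      then obtain b v where "w = b # v" using Cons.prems by (cases w) auto
      moreover from this have "f b < f a" using True Cons.prems by (auto simp: not_le)
      ultimately show ?thesis by (metis append_Nil)
    next
      case False
      then show ?thesis using Cons.IH by (metis append_Cons)
    qed
  qed simp
  then show thesis using that by blast
qed

context qweyl
begin

lemma swap_rel:
  assumes "fst a < n" "fst b < n" "gkey b < gkey a"
  shows "\<exists>s t. eqA n q \<Lambda> (fa_word [a, b]) (fa_add (fa_smult s (fa_word [b, a])) (fa_smult t (fa_word [])))"
proof -
  have XX: "fa_mult (X i) (X j) = fa_word [(i, True), (j, True)]"
    and XY: "fa_mult (X i) (Y j) = fa_word [(i, True), (j, False)]"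
    and YX: "fa_mult (Y i) (X j) = fa_word [(i, False), (j, True)]"
    and YY: "fa_mult (Y i) (Y j) = fa_word [(i, False), (j, False)]" for i j
    by (simp_all add: X_def Y_def fa_gen_eq_word fa_mult_word)
  have direct: ?thesis if "fa_sub (fa_word [a, b]) (fa_smult s (fa_word [b, a])) \<in> rels n q \<Lambda>" for s
  proof -
    have "fa_sub (fa_word [a, b]) (fa_smult s (fa_word [b, a]))
        = fa_sub (fa_word [a, b]) (fa_add (fa_smult s (fa_word [b, a])) (fa_smult 0 (fa_word [])))"
      by (simp add: fa_simps)
    then show ?thesis using rel_ideal.gen[OF that] by (auto simp: eqA_def)
  qed
  \<comment> \<open>The relations led by x_i x_j and x_i y_j with i < j have the sorted pair in
    front; they are solved for the inverted pair by dividing by the nonzero scalar.\<close>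
  have flipped: ?thesis
    if "fa_sub (fa_word [b, a]) (fa_smult s (fa_word [a, b])) \<in> rels n q \<Lambda>" "s \<noteq> 0" for s
  proof -
    have "fa_smult (- inverse s) (fa_sub (fa_word [b, a]) (fa_smult s (fa_word [a, b])))
        = fa_sub (fa_word [a, b]) (fa_add (fa_smult (inverse s) (fa_word [b, a])) (fa_smult 0 (fa_word [])))"
      using that(2) by (auto simp: fa_simps algebra_simps)
    then show ?thesis using ideal_smult[OF rel_ideal.gen[OF that(1)], of "- inverse s"]
      by (auto simp: eqA_def)
  qed
  obtain i ba j bb where ab: "a = (i, ba)" "b = (j, bb)" by (metis surj_pair)
  have ij: "i < n" "j < n" using assms ab by auto
  have "j \<le> i" using assms(3) by (auto simp: ab gkey_def split: if_splits)
  show ?thesis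
  proof (cases "i = j")
    case True
    then have tf: "ba" "\<not> bb" using assms(3) by (auto simp: ab gkey_def split: if_splits)
    have "fa_sub (fa_sub (fa_mult (X i) (Y i)) (fa_smult (q i) (fa_mult (Y i) (X i)))) fa_one \<in> rels n q \<Lambda>"
      using ij by (auto simp: rels_def)
    moreover have "fa_sub (fa_sub (fa_mult (X i) (Y i)) (fa_smult (q i) (fa_mult (Y i) (X i)))) fa_one
        = fa_sub (fa_word [a, b]) (fa_add (fa_smult (q i) (fa_word [b, a])) (fa_smult 1 (fa_word [])))"
      using True tf by (simp add: ab XY YX fa_one_eq_word) (simp add: fa_simps algebra_simps)
    ultimately show ?thesis using rel_ideal.gen unfolding eqA_def by metis
  next
    case False
    then have ji: "j < i" using \<open>j \<le> i\<close> by simp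
    show ?thesis
    proof (cases ba; cases bb)
      assume "ba" "bb"
      then show ?thesis using ji ij L_nz[of j i]
        by (intro flipped[of "\<Lambda> j i"]) (auto simp: ab rels_def XX)
    next
      assume "ba" "\<not> bb"
      then show ?thesis using ji ij
        by (intro direct[of "\<Lambda> j i"]) (auto simp: ab rels_def XX XY YX YY)
    next
      assume "\<not> ba" "bb"
      then show ?thesis using ji ij L_nz[of i j]
        by (intro flipped[of "\<Lambda> i j"]) (auto simp: ab rels_def XX XY YX YY)
    next
      assume "\<not> ba" "\<not> bb"
      then show ?thesis using ji ij
        by (intro direct[of "\<Lambda> i j"]) (auto simp: ab rels_def XX XY YX YY)
    qed
  qed
qed

text \<open>Bubble sort terminates: swapping an inverted pair keeps the length and lowers the key
  word lexicographically, while the constant term of a relation shortens the word. Hence the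
  induction along \<open>lenlex\<close>.\<close>

lemma word_eqA_sorted_comb:
  assumes "\<And>a. a \<in> set w \<Longrightarrow> fst a < n"
  shows "\<exists>f\<in>sorted_comb n. eqA n q \<Lambda> (fa_word w) f"
  using assms
proof (induction w rule: wf_induct_rule[OF wf_inv_image[OF wf_lenlex[OF wf_less_than], of "map gkey"]])
  case (1 w)
  show ?case
  proof (cases "sorted (map gkey w)")
    case True
    then have "fa_word w \<in> sorted_comb n"
      using 1(2) by (auto simp: sorted_comb_def FA_word) (auto simp: supp_def fa_word_def split: if_splits)
    then show ?thesis using eqA_refl by blast
  next
    case False
    then obtain u a b v where w: "w = u @ a # b # v" and lt: "gkey b < gkey a"
      using not_sorted_map_decomp by blast
    have val: "fst a < n" "fst b < n" "\<And>x. x \<in> set u \<Longrightarrow> fst x < n" "\<And>x. x \<in> set v \<Longrightarrow> fst x < n"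
      using 1(2) by (auto simp: w)
    obtain s t where st: "eqA n q \<Lambda> (fa_word [a, b]) (fa_add (fa_smult s (fa_word [b, a])) (fa_smult t (fa_word [])))"
      using swap_rel[OF val(1,2) lt] by blast
    have eq: "eqA n q \<Lambda> (fa_word w) (fa_add (fa_smult s (fa_word (u @ b # a # v))) (fa_smult t (fa_word (u @ v))))"
      using rel_ideal.mult[OF st[unfolded eqA_def] FA_word[of u] FA_word[of v]] val(3,4)
      by (simp add: eqA_def w fa_mult_sub_left fa_mult_sub_right fa_mult_add_left fa_mult_add_right
          fa_mult_smult_left fa_mult_smult_right fa_mult_word)
    have "(u @ b # a # v, w) \<in> inv_image (lenlex less_than) (map gkey)"
      using lt by (simp add: w lenlex_conv lex_append_leftI)
    moreover have "fst x < n" if "x \<in> set (u @ b # a # v)" for x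
      using that by (auto simp: val(1,2) dest!: val(3,4))
    ultimately obtain f where f: "f \<in> sorted_comb n" "eqA n q \<Lambda> (fa_word (u @ b # a # v)) f"
      using 1(1) by blast
    have "(u @ v, w) \<in> inv_image (lenlex less_than) (map gkey)"
      by (simp add: w lenlex_conv)
    moreover have "fst x < n" if "x \<in> set (u @ v)" for x
      using that by (auto simp: val(1,2) dest!: val(3,4))
    ultimately obtain g where g: "g \<in> sorted_comb n" "eqA n q \<Lambda> (fa_word (u @ v)) g"
      using 1(1) by blast
    have "eqA n q \<Lambda> (fa_word w) (fa_add (fa_smult s f) (fa_smult t g))"
      using eqA_trans[OF eq] eqA_add eqA_smult f g by blast
    then show ?thesis using f g sorted_comb_add sorted_comb_smult by blast
  qed
qed

lemma eqA_sorted_comb: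
  assumes "f \<in> FA n"
  shows "\<exists>g\<in>sorted_comb n. eqA n q \<Lambda> f g"
  using assms
proof (induction rule: FA_induct)
  case zero
  have "fa_zero \<in> sorted_comb n" by (simp add: sorted_comb_def FA_zero) (simp add: supp_def fa_simps)
  then show ?case using eqA_refl by blast
next
  case (add f g)
  then show ?case using eqA_add sorted_comb_add by blast
next
  case (word \<kappa> w)
  then show ?case using word_eqA_sorted_comb eqA_smult sorted_comb_smult by blast
qed

subsection \<open>The embedding into the torus\<close>

definition tgen :: "gen \<Rightarrow> (nat \<Rightarrow>\<^sub>0 int) \<Rightarrow>\<^sub>0 'k" where
  "tgen a = (if snd a then tx (fst a) else ty (fst a))"

fun wval :: "gen list \<Rightarrow> (nat \<Rightarrow>\<^sub>0 int) \<Rightarrow>\<^sub>0 'k" where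
  "wval [] = 1"
| "wval (a # w) = tgen a \<odot> wval w"

lemma wval_append: "wval (u @ v) = wval u \<odot> wval v"
  by (induction u) (simp_all add: tmult_assoc)

lemma wval_weyl: "(\<And>a. a \<in> set w \<Longrightarrow> fst a < n) \<Longrightarrow> wval w \<in> weyl"
  by (induction w) (auto simp: weyl_one tgen_def intro!: weyl.intros)

definition emb :: "'k fa \<Rightarrow> (nat \<Rightarrow>\<^sub>0 int) \<Rightarrow>\<^sub>0 'k" where
  "emb f = (\<Sum>w\<in>supp f. scal (f w) \<odot> wval w)"

lemma emb_eq_sum:
  assumes "finite S" "supp f \<subseteq> S"
  shows "emb f = (\<Sum>w\<in>S. scal (f w) \<odot> wval w)"
  unfolding emb_def by (rule sum.mono_neutral_left) (use assms in \<open>auto simp: supp_def\<close>)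

lemma emb_word: "emb (fa_word w) = wval w"
  by (subst emb_eq_sum[of "{w}"]) (auto simp: supp_def fa_word_def)

lemma emb_add:
  assumes "f \<in> FA n" "g \<in> FA n"
  shows "emb (fa_add f g) = emb f + emb g"
proof -
  have "finite (supp f \<union> supp g)" "supp (fa_add f g) \<subseteq> supp f \<union> supp g"
    using assms by (auto simp: FA_iff) (auto simp: supp_def fa_simps)
  then show ?thesis
    by (simp add: emb_eq_sum[of "supp f \<union> supp g"] fa_add_def single_add tmult_add_left sum.distrib)
qed

lemma emb_sub:
  assumes "f \<in> FA n" "g \<in> FA n"
  shows "emb (fa_sub f g) = emb f - emb g"
proof -
  have "fa_add (fa_sub f g) g = f" by (simp add: fa_simps)
  then show ?thesis using emb_add[OF FA_sub[OF assms] assms(2)] by simp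
qed

lemma emb_smult:
  assumes "f \<in> FA n"
  shows "emb (fa_smult \<kappa> f) = scal \<kappa> \<odot> emb f"
proof -
  have "finite (supp f)" "supp (fa_smult \<kappa> f) \<subseteq> supp f"
    using assms by (auto simp: FA_iff) (auto simp: supp_def fa_simps)
  then show ?thesis
    by (simp add: emb_eq_sum[of "supp f"] fa_smult_def tmult_sum_right scal_scal)
qed

lemma emb_zero: "emb fa_zero = 0"
  by (simp add: emb_def supp_def fa_zero_def)

text \<open>Bilinearity reduces both factors to words, where concatenation becomes the torus
  product.\<close>

lemma emb_mult:
  assumes "f \<in> FA n" "g \<in> FA n"
  shows "emb (fa_mult f g) = emb f \<odot> emb g"
  using assms(1)
proof (induction rule: FA_induct)
  case zero
  have "fa_mult fa_zero g = fa_zero" by (simp add: fa_mult_def fa_zero_def)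
  then show ?case by (simp add: emb_zero)
next
  case (add f h)
  then show ?case using assms(2) by (simp add: fa_mult_add_left emb_add FA_mult tmult_add_left)
next
  case (word \<kappa> w)
  then have w: "(fa_word w :: 'k fa) \<in> FA n" by (rule FA_word)
  have "emb (fa_mult (fa_word w) g) = wval w \<odot> emb g"
    using assms(2)
  proof (induction rule: FA_induct)
    case zero
    have "fa_mult (fa_word w) fa_zero = (fa_zero :: 'k fa)" by (simp add: fa_mult_def fa_zero_def)
    then show ?case by (simp add: emb_zero)
  next
    case (add f h)
    then show ?case using w by (simp add: fa_mult_add_right emb_add FA_mult tmult_add_right)
  next
    case (word \<kappa> v)
    then have v: "(fa_word v :: 'k fa) \<in> FA n" by (rule FA_word)
    have "emb (fa_word (w @ v)) = wval w \<odot> wval v" by (simp add: emb_word wval_append)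
    moreover have "(fa_word (w @ v) :: 'k fa) \<in> FA n" using FA_mult[OF w v] by (simp add: fa_mult_word)
    ultimately show ?case
      using v by (simp add: fa_mult_smult_right fa_mult_word emb_smult emb_word tmult_scal_right)
  qed
  then show ?case using assms(2) w
    by (simp add: fa_mult_smult_left emb_smult FA_mult emb_word tmult_assoc)
qed

lemma emb_one: "emb fa_one = 1"
  by (simp add: fa_one_eq_word emb_word)

lemma emb_X: "emb (X i) = tx i" and emb_Y: "emb (Y i) = ty i"
  by (simp_all add: X_def Y_def fa_gen_eq_word emb_word tgen_def)

lemma emb_rels:
  assumes "r \<in> rels n q \<Lambda>"
  shows "emb r = 0"
  using assms unfolding rels_def
  by (auto simp: emb_sub emb_smult emb_mult emb_X emb_Y emb_one FA_sub FA_smult FA_mult FA_X FA_Y FA_one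
      tx_tx ty_ty tx_ty_less tx_ty_greater weyl_rel)

lemma emb_ideal: "r \<in> rel_ideal n q \<Lambda> \<Longrightarrow> emb r = 0"
proof (induction r rule: rel_ideal.induct)
  case (mult a u v)
  then show ?case using ideal_FA[OF mult(1)] by (simp add: emb_mult FA_mult)
qed (auto simp: emb_rels emb_zero emb_add ideal_FA)

text \<open>x_k has leading exponent \<open>ex k\<close> and y_k has \<open>ez k - ex k\<close>;
  additivity turns leading exponents into letter counts.\<close>

lemma wval_leading_exponent:
  assumes "\<And>a. a \<in> set w \<Longrightarrow> fst a < n"
  shows "wval w \<noteq> 0"
    and "lookup (Max (keys (wval w))) (Suc (2 * i)) = int (count (mset w) (i, False))"
    and "lookup (Max (keys (wval w))) (2 * i) = int (count (mset w) (i, True)) - int (count (mset w) (i, False))"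
proof -
  have keys_ty: "keys (ty k) = {- ex k, ez k - ex k}" if "k < n" for k
    using q_neq_1[OF that] ez_pos[of k]
    by (auto simp: ty_def in_keys_iff lookup_minus lookup_single when_def split: if_splits)
  have gen: "tgen a \<noteq> 0 \<and> Max (keys (tgen a)) = (if snd a then ex (fst a) else ez (fst a) - ex (fst a))"
    if "fst a < n" for a
  proof (cases "snd a")
    case True
    have "tx (fst a) \<noteq> 0" unfolding tx_def by (metis lookup_single_eq lookup_zero zero_neq_one)
    then show ?thesis using True by (simp add: tgen_def) (simp add: tx_def)
  next
    case False
    have "- ex (fst a) \<le> ez (fst a) - ex (fst a)" using less_imp_le[OF ez_pos[of "fst a"]] by simp
    then show ?thesis using False keys_ty[OF that] by (auto simp: tgen_def max_def)
  qed
  have "wval w \<noteq> 0 \<and> lookup (Max (keys (wval w))) (Suc (2 * i)) = int (count (mset w) (i, False))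
    \<and> lookup (Max (keys (wval w))) (2 * i) = int (count (mset w) (i, True)) - int (count (mset w) (i, False))"
    using assms
  proof (induction w)
    case Nil
    then show ?case by simp
  next
    case (Cons a w)
    have IH: "wval w \<noteq> 0" "lookup (Max (keys (wval w))) (Suc (2 * i)) = int (count (mset w) (i, False))"
      "lookup (Max (keys (wval w))) (2 * i) = int (count (mset w) (i, True)) - int (count (mset w) (i, False))"
      using Cons by auto
    have a: "tgen a \<noteq> 0" "Max (keys (tgen a)) = (if snd a then ex (fst a) else ez (fst a) - ex (fst a))"
      using gen[of a] Cons.prems by auto
    show ?case
      using Max_keys_tmult(1)[OF a(1) IH(1)] a IH by (cases a) (auto simp: lookup_exp)
  qed
  then show "wval w \<noteq> 0"
    "lookup (Max (keys (wval w))) (Suc (2 * i)) = int (count (mset w) (i, False))"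
    "lookup (Max (keys (wval w))) (2 * i) = int (count (mset w) (i, True)) - int (count (mset w) (i, False))"
    by blast+
qed

text \<open>Odd places of the leading exponent count the letters y_i, and the even places then give
  the letters x_i. A sorted word is determined by its letter counts.\<close>

lemma sorted_word_eqI:
  assumes "\<And>a. a \<in> set v \<Longrightarrow> fst a < n" "\<And>a. a \<in> set w \<Longrightarrow> fst a < n"
    and "sorted (map gkey v)" "sorted (map gkey w)"
    and "Max (keys (wval v)) = Max (keys (wval w))"
  shows "v = w"
proof -
  have F: "count (mset v) (i, False) = count (mset w) (i, False)" for i
    using wval_leading_exponent(2)[of v i, OF assms(1)] wval_leading_exponent(2)[of w i, OF assms(2)] assms(5) by simp
  have T: "count (mset v) (i, True) = count (mset w) (i, True)" for i
    using wval_leading_exponent(3)[of v i, OF assms(1)] wval_leading_exponent(3)[of w i, OF assms(2)] assms(5) F[of i] by simp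
  have "mset v = mset w"
  proof (rule multiset_eqI)
    fix a :: gen
    show "count (mset v) a = count (mset w) a"
      using F[of "fst a"] T[of "fst a"] by (cases a; cases "snd a") auto
  qed
  then have "mset (map gkey v) = mset (map gkey w)" by simp
  then have "map gkey v = map gkey w"
    using assms(3,4) by (metis properties_for_sort)
  then show ?thesis using inj_gkey by simp
qed

text \<open>Sorted words have distinct leading exponents, so the largest of these cannot cancel.
  This is the linear independence of the ordered monomials.\<close>

lemma emb_sorted_comb_eq_0:
  assumes "f \<in> sorted_comb n" "emb f = 0"
  shows "f = fa_zero"
proof (rule ccontr)
  assume "f \<noteq> fa_zero"
  then have ne: "supp f \<noteq> {}" by (auto simp: supp_def fa_zero_def fun_eq_iff)
  have fin: "finite (supp f)" and val: "\<And>w a. w \<in> supp f \<Longrightarrow> a \<in> set w \<Longrightarrow> fst a < n"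
    and srt: "\<And>w. w \<in> supp f \<Longrightarrow> sorted (map gkey w)"
    using assms(1) by (auto simp: sorted_comb_def FA_iff)
  define lm where "lm w = Max (keys (wval w))" for w
  have "Max (lm ` supp f) \<in> lm ` supp f" using fin ne by simp
  then obtain w where w: "Max (lm ` supp f) = lm w" "w \<in> supp f" by (rule imageE)
  have "f v * lookup (wval v) (lm w) = (if v = w then f w * lookup (wval w) (lm w) else 0)"
    if v: "v \<in> supp f" for v
  proof (cases "v = w")
    case False
    have "lm v \<noteq> lm w"
      using sorted_word_eqI[of v w] val srt v w(2) False unfolding lm_def by blast
    moreover have "lm v \<le> lm w" using Max_ge[of "lm ` supp f" "lm v"] w(1) v fin by simp
    ultimately have "lm w \<notin> keys (wval v)"
      unfolding lm_def by (metis Max_ge finite_keys leD order_le_less)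
    then show ?thesis using False by (simp add: in_keys_iff)
  qed simp
  then have "lookup (emb f) (lm w) = (\<Sum>v\<in>supp f. if v = w then f w * lookup (wval w) (lm w) else 0)"
    unfolding emb_def lookup_sum by (intro sum.cong) auto
  also have "\<dots> = f w * lookup (wval w) (lm w)" using w(2) fin by simp
  also have "\<dots> \<noteq> 0"
  proof -
    have "lm w \<in> keys (wval w)"
      unfolding lm_def using wval_leading_exponent(1)[OF val[OF w(2)]] by (intro Max_in) auto
    then show ?thesis using w(2) by (simp add: supp_def in_keys_iff)
  qed
  finally show False using assms(2) by simp
qed

text \<open>The kernel of \<open>emb\<close> on \<open>FA n\<close> is exactly the ideal: a
  difference reduces modulo the ideal to a combination of sorted words, on which \<open>emb\<close>
  is injective.\<close>

lemma eqA_iff_emb: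
  assumes "f \<in> FA n" "g \<in> FA n"
  shows "eqA n q \<Lambda> f g \<longleftrightarrow> emb f = emb g"
proof
  assume "eqA n q \<Lambda> f g"
  then show "emb f = emb g" using emb_ideal emb_sub[OF assms] by (simp add: eqA_def)
next
  assume eq: "emb f = emb g"
  obtain h where h: "h \<in> sorted_comb n" "eqA n q \<Lambda> (fa_sub f g) h"
    using eqA_sorted_comb FA_sub[OF assms] by blast
  have "h \<in> FA n" using h(1) by (simp add: sorted_comb_def)
  then have "emb h = emb (fa_sub f g)"
    using h(2) emb_ideal emb_sub[OF FA_sub[OF assms], of h] by (simp add: eqA_def)
  then have "h = fa_zero" using emb_sorted_comb_eq_0[OF h(1)] emb_sub[OF assms] eq by simp
  then show "eqA n q \<Lambda> f g" using h(2) by (simp add: eqA_def fa_simps)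
qed

lemma emb_image: "emb ` FA n = weyl"
proof
  have "emb f \<in> weyl" if "f \<in> FA n" for f
    using that
  proof (induction rule: FA_induct)
    case zero
    then show ?case using weyl.scal[of 0] by (simp add: emb_zero)
  next
    case (add f g)
    then show ?case by (simp add: emb_add weyl.add)
  next
    case (word \<kappa> w)
    have "(fa_word w :: 'k fa) \<in> FA n" "wval w \<in> weyl"
      using FA_word[OF word] wval_weyl[OF word] by blast+
    then show ?case by (simp add: emb_smult emb_word weyl.intros)
  qed
  then show "emb ` FA n \<subseteq> weyl" by blast
  have "u \<in> emb ` FA n" if "u \<in> weyl" for u
    using that
  proof (induction u rule: weyl.induct)
    case (tx k)
    then show ?case using emb_X FA_X by (metis imageI)
  next
    case (ty k)
    then show ?case using emb_Y FA_Y by (metis imageI)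
  next
    case (scal \<kappa>)
    have "emb (fa_smult \<kappa> fa_one) = scal \<kappa>" by (simp add: emb_smult[OF FA_one] emb_one)
    then show ?case using FA_smult[OF FA_one] by (metis imageI)
  next
    case (add u v)
    then obtain f g where "f \<in> FA n" "g \<in> FA n" "u = emb f" "v = emb g" by blast
    then have "u + v = emb (fa_add f g)" "fa_add f g \<in> FA n" by (simp_all add: emb_add FA_add)
    then show ?case by (rule image_eqI)
  next
    case (tmult u v)
    then obtain f g where "f \<in> FA n" "g \<in> FA n" "u = emb f" "v = emb g" by blast
    then have "u \<odot> v = emb (fa_mult f g)" "fa_mult f g \<in> FA n" by (simp_all add: emb_mult FA_mult)
    then show ?case by (rule image_eqI)
  qed
  then show "weyl \<subseteq> emb ` FA n" by blast
qed

end

section \<open>Transport of the automorphism along the embedding\<close>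

theorem theorem2p1:
  fixes n :: nat and q :: "nat \<Rightarrow> 'k::field" and \<Lambda> :: "nat \<Rightarrow> nat \<Rightarrow> 'k"
    and \<phi> :: "'k fa \<Rightarrow> 'k fa"
  assumes n: "n \<ge> 1"
    and q_nz: "\<forall>i<n. q i \<noteq> 0"
    and q_nroot: "\<forall>i<n. \<forall>m::nat. m > 0 \<longrightarrow> q i ^ m \<noteq> 1"
    and L_nz: "\<forall>i<n. \<forall>j<n. \<Lambda> i j \<noteq> 0"
    and L_inv: "\<forall>i<n. \<forall>j<n. \<Lambda> i j = inverse (\<Lambda> j i)"
    and L_diag: "\<forall>i<n. \<Lambda> i i = 1"
    and aut: "is_autA n q \<Lambda> \<phi>"
  shows "\<exists>\<sigma> \<alpha>. \<sigma> permutes {..<n} \<and>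
           (\<forall>i<n. \<alpha> i \<noteq> (0::'k) \<and>
             ((eqA n q \<Lambda> (\<phi> (X i)) (fa_smult (\<alpha> i) (X (\<sigma> i)))
               \<and> eqA n q \<Lambda> (\<phi> (Y i)) (fa_smult (inverse (\<alpha> i)) (Y (\<sigma> i)))
               \<and> q i = q (\<sigma> i))
            \<or> (eqA n q \<Lambda> (\<phi> (X i)) (fa_smult (\<alpha> i) (Y (\<sigma> i)))
               \<and> eqA n q \<Lambda> (\<phi> (Y i)) (fa_smult (- (inverse (q i) * inverse (\<alpha> i))) (X (\<sigma> i)))
               \<and> q i = inverse (q (\<sigma> i)))))"
proof -
  interpret qweyl n q \<Lambda>
    by unfold_locales (use q_nz q_nroot L_nz L_inv in blast)+
  note hom = aut[unfolded is_autA_def]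
  have \<phi>_FA: "\<phi> f \<in> FA n" if "f \<in> FA n" for f
    using hom that by blast
  have \<phi>_eq_iff: "emb (\<phi> f) = emb (\<phi> g) \<longleftrightarrow> emb f = emb g" if fg: "f \<in> FA n" "g \<in> FA n" for f g
  proof -
    have "eqA n q \<Lambda> (\<phi> f) (\<phi> g) \<longleftrightarrow> eqA n q \<Lambda> f g" using hom fg by blast
    then show ?thesis by (simp only: eqA_iff_emb fg \<phi>_FA)
  qed
  have \<phi>_add: "emb (\<phi> (fa_add f g)) = emb (\<phi> f) + emb (\<phi> g)" if fg: "f \<in> FA n" "g \<in> FA n" for f g
  proof -
    have "eqA n q \<Lambda> (\<phi> (fa_add f g)) (fa_add (\<phi> f) (\<phi> g))" using hom fg by blast
    then show ?thesis by (simp only: eqA_iff_emb fg \<phi>_FA FA_add emb_add)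
  qed
  have \<phi>_mult: "emb (\<phi> (fa_mult f g)) = tmult (emb (\<phi> f)) (emb (\<phi> g))"
    if fg: "f \<in> FA n" "g \<in> FA n" for f g
  proof -
    have "eqA n q \<Lambda> (\<phi> (fa_mult f g)) (fa_mult (\<phi> f) (\<phi> g))" using hom fg by blast
    then show ?thesis by (simp only: eqA_iff_emb fg \<phi>_FA FA_mult emb_mult)
  qed
  have \<phi>_smult: "emb (\<phi> (fa_smult \<kappa> f)) = tmult (scal \<kappa>) (emb (\<phi> f))" if f: "f \<in> FA n" for \<kappa> f
  proof -
    have "eqA n q \<Lambda> (\<phi> (fa_smult \<kappa> f)) (fa_smult \<kappa> (\<phi> f))" using hom f by blast
    then show ?thesis by (simp only: eqA_iff_emb f \<phi>_FA FA_smult emb_smult)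
  qed
  have \<phi>_one: "emb (\<phi> fa_one) = 1"
  proof -
    have "eqA n q \<Lambda> (\<phi> fa_one) fa_one" using hom by blast
    then show ?thesis by (simp only: eqA_iff_emb \<phi>_FA FA_one emb_one)
  qed
  \<comment> \<open>The map induced by \<open>\<phi>\<close> on the image of \<open>emb\<close>; by
    \<open>\<phi>_eq_iff\<close> the chosen preimage does not affect the value.\<close>
  define \<psi> where "\<psi> u = emb (\<phi> (SOME f. f \<in> FA n \<and> emb f = u))" for u
  have \<psi>_emb: "\<psi> (emb f) = emb (\<phi> f)" if "f \<in> FA n" for f
  proof -
    let ?g = "SOME g. g \<in> FA n \<and> emb g = emb f"
    have "?g \<in> FA n \<and> emb ?g = emb f" by (rule someI[of _ f]) (use that in simp)
    then show ?thesis unfolding \<psi>_def using \<phi>_eq_iff that by blast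
  qed
  have weylE: "\<exists>f\<in>FA n. u = emb f" if "u \<in> weyl" for u
    using that emb_image by auto
  have emb_weyl: "emb f \<in> weyl" if "f \<in> FA n" for f
    using that emb_image by auto
  interpret qweyl_aut n q \<Lambda> \<psi>
  proof
    fix u v assume "u \<in> weyl" "v \<in> weyl"
    then obtain f g where fg: "f \<in> FA n" "u = emb f" "g \<in> FA n" "v = emb g" using weylE by metis
    show "\<psi> (u + v) = \<psi> u + \<psi> v"
      using fg \<psi>_emb[OF FA_add[OF fg(1,3)]] by (simp add: emb_add \<psi>_emb \<phi>_add)
    show "\<psi> (tmult u v) = tmult (\<psi> u) (\<psi> v)"
      using fg \<psi>_emb[OF FA_mult[OF fg(1,3)]] by (simp add: emb_mult \<psi>_emb \<phi>_mult)
    show "\<psi> u = \<psi> v \<Longrightarrow> u = v"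
      using fg by (simp add: \<psi>_emb \<phi>_eq_iff)
  next
    fix u assume "u \<in> weyl"
    then show "\<psi> u \<in> weyl" using weylE \<psi>_emb \<phi>_FA emb_weyl by metis
  next
    fix \<kappa>
    show "\<psi> (scal \<kappa>) = scal \<kappa>"
      using \<psi>_emb[OF FA_smult[OF FA_one], of \<kappa>] by (simp add: emb_smult[OF FA_one] emb_one \<phi>_smult[OF FA_one] \<phi>_one)
  next
    fix v assume "v \<in> weyl"
    then obtain g where g: "g \<in> FA n" "v = emb g" using weylE by blast
    then obtain f where f: "f \<in> FA n" "eqA n q \<Lambda> (\<phi> f) g" using hom by blast
    then have "\<psi> (emb f) = v" using g \<psi>_emb \<phi>_FA by (simp add: eqA_iff_emb)
    then show "\<exists>u\<in>weyl. \<psi> u = v" using f(1) emb_weyl by blast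
  qed
  obtain \<sigma> \<alpha> where \<sigma>: "\<sigma> permutes {..<n}" and \<alpha>: "\<And>i. i < n \<Longrightarrow> \<alpha> i \<noteq> 0 \<and>
     ((\<psi> (tx i) = tmult (scal (\<alpha> i)) (tx (\<sigma> i)) \<and> \<psi> (ty i) = tmult (scal (inverse (\<alpha> i))) (ty (\<sigma> i))
        \<and> q i = q (\<sigma> i))
    \<or> (\<psi> (tx i) = tmult (scal (\<alpha> i)) (ty (\<sigma> i))
        \<and> \<psi> (ty i) = tmult (scal (- (inverse (q i) * inverse (\<alpha> i)))) (tx (\<sigma> i))
        \<and> q i = inverse (q (\<sigma> i))))"
    using qweyl_aut_classification by blast
  have \<sigma>n: "\<sigma> i < n" if "i < n" for i using permutes_in_image[OF \<sigma>, of i] that by simp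
  have pull: "eqA n q \<Lambda> (\<phi> f) (fa_smult \<kappa> g) \<longleftrightarrow> \<psi> (emb f) = tmult (scal \<kappa>) (emb g)"
    if "f \<in> FA n" "g \<in> FA n" for f g \<kappa>
    by (simp only: that eqA_iff_emb \<phi>_FA FA_smult emb_smult \<psi>_emb)
  show ?thesis
    using \<sigma> \<alpha> by (intro exI[of _ \<sigma>] exI[of _ \<alpha>]) (simp add: pull FA_X FA_Y emb_X emb_Y \<sigma>n)
qed

end
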